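(* The Weber kernel group $\Gamma_3$ equals $\Gamma(2)\cap\Gamma_{ns}^+(3)$, and for each $n$ dividing $8$, $$\Gamma_{3n}=\Gamma_n\cap\Gamma_{ns}^+(3).$$
   Context: Write $\zeta_k=e^{2\pi i/k}$. Let $\eta$ be the Dedekind eta function and $$\mathfrak{f}(\tau)=\zeta_{48}^{-1}\frac{\eta\left(\frac{\tau+1}{2}\right)}{\eta(\tau)},\quad \mathfrak{f}_1(\tau)=\frac{\eta\left(\frac{\tau}{2}\right)}{\eta(\tau)},\quad \mathfrak{f}_2(\tau)=\sqrt2\,\frac{\eta(2\tau)}{\eta(\tau)},$$ $(\mathfrak{u}_0,\mathfrak{u}_1,\mathfrak{u}_2)=(\mathfrak{f},\zeta_{16}\mathfrak{f}_1,\zeta_{16}^{-1}\mathfrak{f}_2)$. For $n\mid 24$, the Weber kernel group $\Gamma_n\subset\mathrm{PSL}_2(\mathbb{Z})$ is the group of all $g$ with $\mathfrak{u}_i^{24/n}\circ g=\mathfrak{u}_i^{24/n}$ for $i=0,1,2$. Here $\Gamma(N)$ denotes the image in $\mathrm{PSL}_2(\mathbb{Z})$ of the principal congruence subgroup of level $N$, and $\Gamma_{ns}^+(3)$ is the image in $\mathrm{PSL}_2(\mathbb{Z})$ of the group of matrices in $\mathrm{SL}_2(\mathbb{Z})$ whose reduction modulo $3$ lies in the normalizer of a nonsplit Cartan subgroup of $\mathrm{GL}_2(\mathbb{F}_3)$ (it is a normal subgroup of index $3$ in $\mathrm{PSL}_2(\mathbb{Z})$). *)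

theory Defs
  imports
    "HOL-Analysis.Analysis"
    "HOL-Algebra.Group_Action"
    "HOL-Algebra.Subrings"
    "HOL-Number_Theory.Cong"
begin

subsection \<open>The Weber functions\<close>

definition zeta :: "nat \<Rightarrow> complex" where
  "zeta k = exp (2 * of_real pi * \<i> / of_nat k)"

text \<open>Only meant for \<open>Im \<tau> > 0\<close>, where the product converges. Its factors are
  \<open>1 - q ^ n\<close> for \<open>n \<ge> 1\<close>, with \<open>q = exp (2 \<pi> \<i> \<tau>)\<close>.\<close>

definition dedekind_eta :: "complex \<Rightarrow> complex" where
  "dedekind_eta \<tau> =
     exp (2 * of_real pi * \<i> * \<tau> / 24) * (\<Prod>n. 1 - exp (2 * of_real pi * \<i> * \<tau>) ^ Suc n)"

definition weber_f :: "complex \<Rightarrow> complex" where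
  "weber_f \<tau> = inverse (zeta 48) * dedekind_eta ((\<tau> + 1) / 2) / dedekind_eta \<tau>"

definition weber_f1 :: "complex \<Rightarrow> complex" where
  "weber_f1 \<tau> = dedekind_eta (\<tau> / 2) / dedekind_eta \<tau>"

definition weber_f2 :: "complex \<Rightarrow> complex" where
  "weber_f2 \<tau> = of_real (sqrt 2) * dedekind_eta (2 * \<tau>) / dedekind_eta \<tau>"

definition weber_u :: "nat \<Rightarrow> complex \<Rightarrow> complex" where
  "weber_u i \<tau> =
     (if i = 0 then weber_f \<tau>
      else if i = 1 then zeta 16 * weber_f1 \<tau>
      else inverse (zeta 16) * weber_f2 \<tau>)"


subsection \<open>The modular group and its action on the upper half-plane\<close>

definition SL2Z :: "(int ^ 2 ^ 2) monoid" where
  "SL2Z = \<lparr>carrier = {A. det A = 1}, monoid.mult = (**), one = mat 1\<rparr>"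

definition PSL2Z :: "(int ^ 2 ^ 2) set monoid" where
  "PSL2Z = SL2Z Mod {mat 1, - mat 1}"

definition PSL2Z_proj :: "int ^ 2 ^ 2 \<Rightarrow> (int ^ 2 ^ 2) set" where
  "PSL2Z_proj A = {mat 1, - mat 1} #>\<^bsub>SL2Z\<^esub> A"

definition moebius :: "int ^ 2 ^ 2 \<Rightarrow> complex \<Rightarrow> complex" where
  "moebius A \<tau> =
     (of_int (A $ 1 $ 1) * \<tau> + of_int (A $ 1 $ 2)) / (of_int (A $ 2 $ 1) * \<tau> + of_int (A $ 2 $ 2))"

text \<open>The two representatives \<open>A\<close> and \<open>- A\<close> of an element of \<open>PSL2Z\<close> define the same
  transformation, see \<open>PSL2Z_act_proj\<close> below.\<close>

definition PSL2Z_act :: "(int ^ 2 ^ 2) set \<Rightarrow> complex \<Rightarrow> complex" where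
  "PSL2Z_act g \<tau> = the_elem ((\<lambda>A. moebius A \<tau>) ` g)"

text \<open>Only meant for \<open>n\<close> dividing 24, where \<open>24 div n\<close> is exact.\<close>

definition weber_kernel :: "nat \<Rightarrow> (int ^ 2 ^ 2) set set" where
  "weber_kernel n =
     {g \<in> carrier PSL2Z. \<forall>i \<in> {0, 1, 2}. \<forall>\<tau>. Im \<tau> > 0 \<longrightarrow>
        weber_u i (PSL2Z_act g \<tau>) ^ (24 div n) = weber_u i \<tau> ^ (24 div n)}"

definition principal_congruence :: "nat \<Rightarrow> (int ^ 2 ^ 2) set set" where
  "principal_congruence N =
     PSL2Z_proj ` {A \<in> carrier SL2Z. \<forall>i j. [A $ i $ j = (mat 1 :: int ^ 2 ^ 2) $ i $ j] (mod int N)}"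


subsection \<open>Nonsplit Cartan subgroups modulo 3\<close>

text \<open>The numeral type \<^typ>\<open>3\<close> serves as the field with three elements (its arithmetic is
  modulo 3), and \<^typ>\<open>3 ^ 2 ^ 2\<close> consists of the 2 by 2 matrices over it.\<close>

definition M2F3 :: "(3 ^ 2 ^ 2) ring" where
  "M2F3 = \<lparr>carrier = UNIV, monoid.mult = (**), one = mat 1, zero = 0, add = (+)\<rparr>"

definition GL2F3 :: "(3 ^ 2 ^ 2) monoid" where
  "GL2F3 = units_of M2F3"

text \<open>A nonsplit Cartan subgroup is the multiplicative group of a subfield with \<open>3\<^sup>2\<close>
  elements of the matrix ring.\<close>

definition nonsplit_Cartan :: "(3 ^ 2 ^ 2) set \<Rightarrow> bool" where
  "nonsplit_Cartan C \<longleftrightarrow> (\<exists>K. subfield K M2F3 \<and> card K = 9 \<and> C = K - {\<zero>\<^bsub>M2F3\<^esub>})"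

definition Gamma_ns_plus :: "(3 ^ 2 ^ 2) set \<Rightarrow> (int ^ 2 ^ 2) set set" where
  "Gamma_ns_plus C =
     PSL2Z_proj ` {A \<in> carrier SL2Z. map_matrix of_int A \<in> normalizer GL2F3 C}"


subsection \<open>Well-definedness\<close>

lemma matrix_neg_mult_left:
  fixes A B :: "int ^ 2 ^ 2"
  shows "(- A) ** B = - (A ** B)"
  by (simp add: vec_eq_iff matrix_matrix_mult_def sum_negf)

lemma matrix_neg_mult_right:
  fixes A B :: "int ^ 2 ^ 2"
  shows "A ** (- B) = - (A ** B)"
  by (simp add: vec_eq_iff matrix_matrix_mult_def sum_negf)

lemma det_neg_2:
  fixes A :: "int ^ 2 ^ 2"
  shows "det (- A) = det A"
  by (simp add: det_2)

lemma group_SL2Z: "group SL2Z"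
proof (rule groupI)
  fix A assume A: "A \<in> carrier SL2Z"
  define B :: "int ^ 2 ^ 2" where
    "B = vector [vector [A $ 2 $ 2, - (A $ 1 $ 2)], vector [- (A $ 2 $ 1), A $ 1 $ 1]]"
  have "det B = 1" "B ** A = mat 1"
    using A by (simp_all add: B_def SL2Z_def det_2 vec_eq_iff forall_2 matrix_matrix_mult_def
        sum_2 mat_def mult.commute)
  then show "\<exists>B\<in>carrier SL2Z. B \<otimes>\<^bsub>SL2Z\<^esub> A = \<one>\<^bsub>SL2Z\<^esub>"
    by (auto simp: SL2Z_def)
qed (auto simp: SL2Z_def det_mul matrix_mul_assoc)

lemma normal_center_SL2Z: "{mat 1, - mat 1} \<lhd> SL2Z"
proof -
  interpret group SL2Z by (rule group_SL2Z)
  have "subgroup {mat 1, - mat 1} SL2Z"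
  proof (rule subgroupI)
    show "inv\<^bsub>SL2Z\<^esub> A \<in> {mat 1, - mat 1}" if "A \<in> {mat 1, - mat 1}" for A
    proof -
      have "A \<in> carrier SL2Z" "A \<otimes>\<^bsub>SL2Z\<^esub> A = \<one>\<^bsub>SL2Z\<^esub>"
        using that by (auto simp: SL2Z_def det_neg_2 matrix_neg_mult_left matrix_neg_mult_right)
      then have "inv\<^bsub>SL2Z\<^esub> A = A"
        by (simp add: inv_equality)
      with that show ?thesis by simp
    qed
  qed (auto simp: SL2Z_def det_neg_2 matrix_neg_mult_left matrix_neg_mult_right)
  then show ?thesis
  proof (rule normalI, intro ballI)
    show "{mat 1, - mat 1} #>\<^bsub>SL2Z\<^esub> A = A <#\<^bsub>SL2Z\<^esub> {mat 1, - mat 1}" if "A \<in> carrier SL2Z" for A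
      by (simp add: r_coset_def l_coset_def SL2Z_def matrix_neg_mult_left matrix_neg_mult_right)
  qed
qed

lemma group_PSL2Z: "group PSL2Z"
  unfolding PSL2Z_def using normal_center_SL2Z by (rule normal.factorgroup_is_group)

lemma PSL2Z_proj_eq: "PSL2Z_proj A = {A, - A}"
  by (auto simp: PSL2Z_proj_def r_coset_def SL2Z_def matrix_neg_mult_left)

lemma carrier_PSL2Z: "carrier PSL2Z = PSL2Z_proj ` carrier SL2Z"
  by (auto simp: PSL2Z_def FactGroup_def RCOSETS_def PSL2Z_proj_def)

lemma moebius_minus: "moebius (- A) \<tau> = moebius A \<tau>"
proof -
  have "moebius (- A) \<tau> =
    (- (of_int (A $ 1 $ 1) * \<tau> + of_int (A $ 1 $ 2))) / (- (of_int (A $ 2 $ 1) * \<tau> + of_int (A $ 2 $ 2)))"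
    by (simp add: moebius_def)
  also have "\<dots> = moebius A \<tau>"
    unfolding moebius_def by (rule minus_divide_divide)
  finally show ?thesis .
qed

lemma PSL2Z_act_proj: "PSL2Z_act (PSL2Z_proj A) \<tau> = moebius A \<tau>"
  by (simp add: PSL2Z_act_def PSL2Z_proj_eq moebius_minus)


subsection \<open>Nonsplit Cartan subgroups exist\<close>

lemma arith_3:
  "(2::3) * 2 = 1" "(1::3) + 2 = 0" "(2::3) + 2 = 1" "- (1::3) = 2" "- (2::3) = 1"
  "(3::3) = 0" "(2::3) \<noteq> 0" "(2::3) \<noteq> 1"
  by simp_all

lemma ring_M2F3: "ring M2F3"
proof (rule ringI)
  show "abelian_group M2F3"
  proof (rule abelian_groupI)
    show "\<exists>B\<in>carrier M2F3. B \<oplus>\<^bsub>M2F3\<^esub> A = \<zero>\<^bsub>M2F3\<^esub>" for A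
      by (auto simp: M2F3_def intro: exI[of _ "- A"])
  qed (auto simp: M2F3_def algebra_simps)
  show "Group.monoid M2F3"
    by (rule monoidI) (auto simp: M2F3_def matrix_mul_assoc)
qed (auto simp: M2F3_def matrix_matrix_mult_def vec_eq_iff sum.distrib algebra_simps)

lemma nonsplit_Cartan_exists: "\<exists>C. nonsplit_Cartan C"
proof -
  define m :: "3 \<Rightarrow> 3 \<Rightarrow> 3 ^ 2 ^ 2" where
    "m a b = vector [vector [a, - b], vector [b, a]]" for a b
  define K where "K = (\<lambda>(a, b). m a b) ` UNIV"
  have m_K: "m a b \<in> K" for a b
    by (auto simp: K_def)
  have K_E: "\<exists>a b. A = m a b" if "A \<in> K" for A
    using that by (auto simp: K_def)
  have m_add: "m a b + m c d = m (a + c) (b + d)" for a b c d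
    by (simp add: m_def vec_eq_iff forall_2)
  have m_mult: "m a b ** m c d = m (a * c - b * d) (a * d + b * c)" for a b c d
    by (simp add: m_def vec_eq_iff forall_2 matrix_matrix_mult_def sum_2 algebra_simps)
  have m_inj: "m a b = m c d \<longleftrightarrow> a = c \<and> b = d" for a b c d
    by (auto simp: m_def vec_eq_iff forall_2)
  have m_0: "m 0 0 = 0" and m_1: "m 1 0 = mat 1"
    by (simp_all add: m_def vec_eq_iff forall_2 mat_def)
  have cases3: "x = 0 \<or> x = 1 \<or> x = 2" for x :: 3
    using exhaust_3[of x] by auto
  have m_inv: "\<exists>c d. m a b ** m c d = mat 1" if "m a b \<noteq> 0" for a b
  proof -
    have "\<exists>c d. a * c - b * d = 1 \<and> a * d + b * c = 0"
      using cases3[of a] cases3[of b] that m_0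
      by (elim disjE) (force simp: arith_3 intro: exI[of _ 0] exI[of _ 1] exI[of _ 2])+
    then show ?thesis
      by (metis m_mult m_1)
  qed
  have "card K = 9"
    unfolding K_def by (subst card_image) (auto simp: inj_on_def m_inj card_cartesian_product simp flip: UNIV_Times_UNIV)
  moreover have "subfield K M2F3"
  proof -
    interpret ring M2F3 by (rule ring_M2F3)
    have neg: "\<ominus>\<^bsub>M2F3\<^esub> m a b = m (- a) (- b)" for a b
      by (rule minus_equality) (simp_all add: M2F3_def m_add m_0)
    have sub: "subring K M2F3"
    proof (rule subringI)
      fix A B assume "A \<in> K" "B \<in> K"
      then obtain a b c d where "A = m a b" "B = m c d"
        using K_E by metis
      then show "\<ominus>\<^bsub>M2F3\<^esub> A \<in> K" "A \<otimes>\<^bsub>M2F3\<^esub> B \<in> K" "A \<oplus>\<^bsub>M2F3\<^esub> B \<in> K"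
        by (simp_all add: neg m_K) (simp_all add: M2F3_def m_mult m_add m_K)
    qed (use m_K[of 1 0] m_1 in \<open>auto simp: M2F3_def\<close>)
    have comm: "A ** B = B ** A" if "A \<in> K" "B \<in> K" for A B
      using K_E[OF that(1)] K_E[OF that(2)] by (auto simp: m_mult algebra_simps)
    have inv: "\<exists>B\<in>K. A ** B = mat 1" if "A \<in> K" "A \<noteq> 0" for A
      using K_E[OF that(1)] that(2) m_inv m_K by metis
    have non0: "(mat 1 :: 3 ^ 2 ^ 2) \<noteq> 0"
      by (simp add: m_inj flip: m_0 m_1)
    show ?thesis
    proof (rule subfieldI[OF subcringI[OF sub]])
      show "A \<otimes>\<^bsub>M2F3\<^esub> B = B \<otimes>\<^bsub>M2F3\<^esub> A" if "A \<in> K" "B \<in> K" for A B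
        using comm[OF that] by (simp add: M2F3_def)
      have "A \<noteq> 0" "B \<noteq> 0" if "A ** B = mat 1" for A B :: "3 ^ 2 ^ 2"
        using that non0 by auto
      with inv comm show "Units (M2F3\<lparr>carrier := K\<rparr>) = K - {\<zero>\<^bsub>M2F3\<^esub>}"
        by (simp add: Units_def M2F3_def set_eq_iff) metis
    qed
  qed
  ultimately show ?thesis
    unfolding nonsplit_Cartan_def by blast
qed

end

theory Submission
  imports Defs "HOL-Complex_Analysis.Cauchy_Integral_Formula"
begin

text \<open>The generator \<open>T\<close> of the modular group permutes the functions \<open>u\<^sub>i\<^sup>8\<close> up to a primitive
  third root of unity, and \<open>S\<close> permutes them. Hence every \<open>g\<close> maps \<open>u\<^sub>i\<^sup>8\<close> to
  \<open>\<chi> g * u\<^sub>j\<^sup>8\<close>, where \<open>j\<close> depends only on \<open>g\<close> modulo 2 and \<open>\<chi>\<close> is the character of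
  \<open>\<eta>\<^sup>8\<close>, a cubic character whose kernel consists of the matrices that reduce modulo 3 into the
  quaternion group of order 8, which is the intersection of the special linear group with the
  normalizer of any nonsplit Cartan subgroup. For \<open>g\<close> in \<open>\<Gamma>\<^sub>n\<close> with \<open>n\<close> dividing 8, the functions
  \<open>u\<^sub>i ^ (8 / n)\<close> are multiplied by cube roots of unity whose \<open>n\<close>th power is \<open>\<chi> g\<close>, so they are
  fixed iff \<open>\<chi> g = 1\<close>.

  The action of \<open>S\<close> is obtained without the transformation law of \<open>\<eta>\<close>. As a function of \<open>z\<close>, the
  product in Jacobi's triple product is determined up to a constant by its zeros and its
  quasi-periodicity (Liouville), so its inversion formula holds with an unknown factor \<open>c \<tau>\<close>. This
  factor cancels in the ratios of the values at half periods, which are the squared ratios of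
  the Weber functions. Together with \<open>f f\<^sub>1 f\<^sub>2 = \<surd>2\<close> this gives the action on sixth powers, and
  continuity and positivity at \<open>\<tau> = \<i>\<close> remove the ambiguity.\<close>

section \<open>The infinite product \<open>\<Prod>n. 1 + a q\<^sup>n\<close>\<close>

text \<open>This is the infinite q-Pochhammer symbol \<open>(- a; q)\<close>; Euler's product in
  \<eta> is \<open>qpoch (- q) q\<close>.\<close>

definition qpoch :: "complex \<Rightarrow> complex \<Rightarrow> complex" where
  "qpoch a q = (\<Prod>n. 1 + a * q ^ n)"

lemma convergent_prod_qpoch:
  fixes a q :: complex
  assumes "norm q < 1"
  shows "convergent_prod (\<lambda>n. 1 + a * q ^ n)"
proof -
  have "summable (\<lambda>n. norm a * norm q ^ n)"
    using assms by (intro summable_mult summable_geometric) auto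
  then show ?thesis
    by (intro abs_convergent_prod_imp_convergent_prod summable_imp_abs_convergent_prod)
       (simp add: norm_mult norm_power)
qed

lemma qpoch_LIMSEQ:
  assumes "norm q < 1"
  shows "(\<lambda>n. \<Prod>k<n. 1 + a * q ^ k) \<longlonglongrightarrow> qpoch a q"
  unfolding qpoch_def
  using has_prod_imp_tendsto'[OF convergent_prod_has_prod[OF convergent_prod_qpoch[OF assms]]] .

lemma qpoch_eq_0_iff:
  assumes "norm q < 1"
  shows "qpoch a q = 0 \<longleftrightarrow> (\<exists>n. 1 + a * q ^ n = 0)"
  unfolding qpoch_def
  using has_prod_eq_0_iff[OF convergent_prod_has_prod[OF convergent_prod_qpoch[OF assms]]]
  by auto

lemma qpoch_euler_nonzero:
  assumes "norm q < 1" "a = - q"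
  shows "qpoch a q \<noteq> 0"
proof
  assume "qpoch a q = 0"
  then obtain n where "q ^ Suc n = 1"
    unfolding qpoch_eq_0_iff[OF assms(1)] using assms(2) by auto
  then have "norm q ^ Suc n = 1"
    by (metis norm_one norm_power)
  with assms(1) show False
    by (metis less_irrefl norm_ge_zero power_less_one_iff zero_less_Suc)
qed

lemma qpoch_head:
  assumes "norm q < 1"
  shows "qpoch a q = (1 + a) * qpoch (a * q) q"
proof (rule LIMSEQ_unique)
  show "(\<lambda>n. \<Prod>k<Suc n. 1 + a * q ^ k) \<longlonglongrightarrow> qpoch a q"
    using qpoch_LIMSEQ[OF assms] by (rule LIMSEQ_Suc)
  have "(\<lambda>n. (1 + a) * (\<Prod>k<n. 1 + (a * q) * q ^ k)) \<longlonglongrightarrow> (1 + a) * qpoch (a * q) q"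
    by (intro tendsto_intros qpoch_LIMSEQ assms)
  then show "(\<lambda>n. \<Prod>k<Suc n. 1 + a * q ^ k) \<longlonglongrightarrow> (1 + a) * qpoch (a * q) q"
    unfolding prod.lessThan_Suc_shift by (simp add: mult.assoc)
qed

lemma norm_power2_less_1: "norm q < 1 \<Longrightarrow> norm (q\<^sup>2 :: complex) < 1"
  by (simp add: norm_power power_less_one_iff)

lemma qpoch_split:
  assumes "norm q < 1"
  shows "qpoch a q = qpoch a (q\<^sup>2) * qpoch (a * q) (q\<^sup>2)"
proof (rule LIMSEQ_unique)
  have "strict_mono (\<lambda>n::nat. 2 * n)"
    by (simp add: strict_mono_def)
  from LIMSEQ_subseq_LIMSEQ[OF qpoch_LIMSEQ[OF assms] this]
  show "(\<lambda>n. \<Prod>k<2 * n. 1 + a * q ^ k) \<longlonglongrightarrow> qpoch a q"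
    by (simp add: o_def)
  have "(\<Prod>k<2 * n. 1 + a * q ^ k) =
      (\<Prod>k<n. 1 + a * (q\<^sup>2) ^ k) * (\<Prod>k<n. 1 + a * q * (q\<^sup>2) ^ k)" for n
    by (induction n) (auto simp: algebra_simps simp flip: power_mult)
  moreover have "(\<lambda>n. (\<Prod>k<n. 1 + a * (q\<^sup>2) ^ k) * (\<Prod>k<n. 1 + a * q * (q\<^sup>2) ^ k))
      \<longlonglongrightarrow> qpoch a (q\<^sup>2) * qpoch (a * q) (q\<^sup>2)"
    by (intro tendsto_intros qpoch_LIMSEQ norm_power2_less_1 assms)
  ultimately show "(\<lambda>n. \<Prod>k<2 * n. 1 + a * q ^ k) \<longlonglongrightarrow> qpoch a (q\<^sup>2) * qpoch (a * q) (q\<^sup>2)"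
    by simp
qed

lemma qpoch_mult_minus:
  assumes "norm q < 1"
  shows "qpoch a q * qpoch (- a) q = qpoch (- a\<^sup>2) (q\<^sup>2)"
proof (rule LIMSEQ_unique)
  have "(\<lambda>n. (\<Prod>k<n. 1 + a * q ^ k) * (\<Prod>k<n. 1 + (- a) * q ^ k)) \<longlonglongrightarrow> qpoch a q * qpoch (- a) q"
    by (intro tendsto_intros qpoch_LIMSEQ assms)
  moreover have "(1 + a * q ^ k) * (1 + (- a) * q ^ k) = 1 + (- a\<^sup>2) * (q\<^sup>2) ^ k" for k
    by (simp add: algebra_simps power2_eq_square power_mult_distrib)
  ultimately show "(\<lambda>n. \<Prod>k<n. 1 + (- a\<^sup>2) * (q\<^sup>2) ^ k) \<longlonglongrightarrow> qpoch a q * qpoch (- a) q"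
    by (simp flip: prod.distrib)
  show "(\<lambda>n. \<Prod>k<n. 1 + (- a\<^sup>2) * (q\<^sup>2) ^ k) \<longlonglongrightarrow> qpoch (- a\<^sup>2) (q\<^sup>2)"
    by (intro qpoch_LIMSEQ norm_power2_less_1 assms)
qed

text \<open>Serves to fix signs at \<tau> = \<i>, where the nome is real. A limit of positive
  partial products is only nonnegative, so the value 0 is excluded through the factors.\<close>

lemma qpoch_of_real_pos:
  fixes a q :: real
  assumes "\<bar>a\<bar> < 1" "0 \<le> q" "q < 1"
  shows "\<exists>r>0. qpoch (of_real a) (of_real q) = of_real r"
proof -
  have q: "norm (of_real q :: complex) < 1"
    using assms by simp
  have pos: "1 + a * q ^ n > 0" for n
  proof -
    have "\<bar>a * q ^ n\<bar> \<le> \<bar>a\<bar> * 1"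
      unfolding abs_mult using assms by (intro mult_left_mono) (auto simp: power_le_one)
    then show ?thesis using assms by linarith
  qed
  have lim: "(\<lambda>n. complex_of_real (\<Prod>k<n. 1 + a * q ^ k)) \<longlonglongrightarrow> qpoch (of_real a) (of_real q)"
    using qpoch_LIMSEQ[OF q, of "of_real a"] by simp
  have "qpoch (of_real a) (of_real q) \<in> \<real>"
    by (rule closed_sequentially[OF closed_complex_Reals _ lim]) simp
  then obtain r where r: "qpoch (of_real a) (of_real q) = of_real r"
    by (auto elim: Reals_cases)
  have "(\<lambda>n. \<Prod>k<n. 1 + a * q ^ k) \<longlonglongrightarrow> r"
    using lim unfolding r tendsto_of_real_iff .
  then have "r \<ge> 0"
    by (rule LIMSEQ_le_const) (intro exI[of _ 0] allI impI less_imp_le prod_pos pos)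
  moreover have "r \<noteq> 0"
  proof
    assume "r = 0"
    then obtain n where "1 + of_real a * of_real q ^ n = (0::complex)"
      using qpoch_eq_0_iff[OF q] r by auto
    then have "of_real (1 + a * q ^ n) = (0::complex)"
      by simp
    then show False
      using pos[of n] by (simp only: of_real_eq_0_iff)
  qed
  ultimately show ?thesis
    using r by (intro exI[of _ r]) auto
qed

lemma holomorphic_qpoch [holomorphic_intros]:
  assumes S: "open S" and a: "a holomorphic_on S" and q: "q holomorphic_on S"
    and q1: "\<And>z. z \<in> S \<Longrightarrow> norm (q z) < 1"
  shows "(\<lambda>z. qpoch (a z) (q z)) holomorphic_on S"
proof (rule holomorphic_uniform_sequence[OF S])
  show "(\<lambda>z. \<Prod>k<n. 1 + a z * q z ^ k) holomorphic_on S" for n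
    by (intro holomorphic_intros a q)
  fix x assume x: "x \<in> S"
  then obtain d where d: "d > 0" "cball x d \<subseteq> S"
    using S open_contains_cball by blast
  have cont: "continuous_on (cball x d) a" "continuous_on (cball x d) q"
    using a q d by (auto intro: holomorphic_on_imp_continuous_on holomorphic_on_subset)
  have "compact (a ` cball x d)"
    by (intro compact_continuous_image cont compact_cball)
  then obtain B where B: "\<And>z. z \<in> cball x d \<Longrightarrow> norm (a z) \<le> B"
    by (metis bounded_iff compact_imp_bounded imageI)
  \<comment> \<open>The maximum of \<open>norm (q z)\<close> on the disc is attained, which makes
    \<open>r\<close> strictly less than 1 and \<open>B * r ^ n\<close> a summable majorant.\<close>
  have "\<exists>z0\<in>cball x d. \<forall>z\<in>cball x d. norm (q z) \<le> norm (q z0)"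
    using d by (intro continuous_attains_sup continuous_intros cont) auto
  then obtain z0 where z0: "z0 \<in> cball x d" "\<And>z. z \<in> cball x d \<Longrightarrow> norm (q z) \<le> norm (q z0)"
    by blast
  define r where "r = norm (q z0)"
  have r: "r < 1" "0 \<le> r" using q1 z0 d by (auto simp: r_def)
  have "uniformly_convergent_on (cball x d) (\<lambda>N z. \<Prod>n<N. 1 + a z * q z ^ n)"
  proof (rule uniformly_convergent_on_prod)
    show "continuous_on (cball x d) (\<lambda>z. a z * q z ^ n)" for n
      by (intro continuous_intros cont)
    show "uniformly_convergent_on (cball x d) (\<lambda>N z. \<Sum>n<N. norm (a z * q z ^ n))"
    proof (rule Weierstrass_m_test'_ev)
      show "\<forall>\<^sub>F n in sequentially. \<forall>z\<in>cball x d. norm (norm (a z * q z ^ n)) \<le> B * r ^ n"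
        using B z0 r by (auto intro!: always_eventually mult_mono power_mono 
            order_trans[OF norm_ge_zero B] simp: norm_mult norm_power r_def simp del: mem_cball)
      show "summable (\<lambda>n. B * r ^ n)"
        using r by (intro summable_mult summable_geometric) auto
    qed
  qed auto
  then obtain l where l: "uniform_limit (cball x d) (\<lambda>N z. \<Prod>n<N. 1 + a z * q z ^ n) l sequentially"
    by (auto simp: uniformly_convergent_on_def)
  have "l z = qpoch (a z) (q z)" if "z \<in> cball x d" for z
    using tendsto_uniform_limitI[OF l that] qpoch_LIMSEQ[OF q1] that d
    by (intro LIMSEQ_unique) auto
  with l have "uniform_limit (cball x d) (\<lambda>N z. \<Prod>n<N. 1 + a z * q z ^ n)
      (\<lambda>z. qpoch (a z) (q z)) sequentially"
    by (metis (mono_tags, lifting) uniform_limit_cong')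
  with d show "\<exists>d>0. cball x d \<subseteq> S \<and> uniform_limit (cball x d) (\<lambda>N z. \<Prod>n<N. 1 + a z * q z ^ n)
      (\<lambda>z. qpoch (a z) (q z)) sequentially"
    by blast
qed

section \<open>Quasi-periodic entire functions\<close>

text \<open>At a simple zero \<open>w\<close> of \<open>P\<close>, both functions divided by
  \<open>z - w\<close> have limits, so the quotient has a removable singularity with value
  \<open>deriv G w / deriv P w\<close>.\<close>

lemma entire_quotient:
  assumes P: "P holomorphic_on UNIV" and G: "G holomorphic_on UNIV"
    and zeros: "\<And>w. P w = 0 \<Longrightarrow> G w = 0 \<and> deriv P w \<noteq> 0"
  shows "\<exists>h. h holomorphic_on UNIV \<and> (\<forall>z. G z = h z * P z)"
proof -
  define h where "h z = (if P z = 0 then deriv G z / deriv P z else G z / P z)" for z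
  have "\<exists>r>0. h holomorphic_on ball w r" for w
  proof (cases "P w = 0")
    case False
    have "isCont P w"
      using P holomorphic_on_imp_continuous_on continuous_on_eq_continuous_at open_UNIV by blast
    then obtain r where r: "r > 0" "\<And>z. dist w z < r \<Longrightarrow> P z \<noteq> 0"
      using False continuous_at_avoid[of w P 0] by auto
    have "(\<lambda>z. G z / P z) holomorphic_on ball w r"
      using r by (intro holomorphic_intros holomorphic_on_subset[OF P] holomorphic_on_subset[OF G]) auto
    then have "h holomorphic_on ball w r"
      by (rule holomorphic_transform) (use r in \<open>auto simp: h_def\<close>)
    with r show ?thesis by blast
  next
    case True
    have "((\<lambda>z. (P z - P w) / (z - w)) \<longlongrightarrow> deriv P w) (at w)"
      using holomorphic_derivI[OF P, of w] by (simp add: has_field_derivative_iff)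
    then have limP: "((\<lambda>z. P z / (z - w)) \<longlongrightarrow> deriv P w) (at w)"
      using True by simp
    have "((\<lambda>z. (G z - G w) / (z - w)) \<longlongrightarrow> deriv G w) (at w)"
      using holomorphic_derivI[OF G, of w] by (simp add: has_field_derivative_iff)
    then have limG: "((\<lambda>z. G z / (z - w)) \<longlongrightarrow> deriv G w) (at w)"
      using zeros[OF True] by simp
    have "\<forall>\<^sub>F z in at w. P z / (z - w) \<noteq> 0"
      using limP zeros[OF True] tendsto_imp_eventually_ne by blast
    then obtain r where r: "r > 0" "\<And>z. z \<noteq> w \<Longrightarrow> dist z w < r \<Longrightarrow> P z \<noteq> 0"
      by (auto simp: eventually_at)
    have "((\<lambda>z. (G z / (z - w)) / (P z / (z - w))) \<longlongrightarrow> h w) (at w)"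
      using tendsto_divide[OF limG limP] zeros[OF True] True by (simp add: h_def)
    moreover have "\<forall>\<^sub>F z in at w. (G z / (z - w)) / (P z / (z - w)) = h z"
      using r by (auto simp: eventually_at h_def intro!: exI[of _ r])
    ultimately have lim: "(h \<longlongrightarrow> h w) (at w)"
      by (rule Lim_transform_eventually)
    have "(\<lambda>z. G z / P z) holomorphic_on ball w r - {w}"
      using r by (intro holomorphic_intros holomorphic_on_subset[OF P] holomorphic_on_subset[OF G])
        (auto simp: dist_commute)
    then have "h holomorphic_on ball w r - {w}"
      by (rule holomorphic_transform) (use r in \<open>auto simp: h_def dist_commute\<close>)
    then have "h holomorphic_on ball w r"
      by (rule no_isolated_singularity'[rotated])
        (use lim in \<open>auto intro: tendsto_within_subset\<close>)
    with r show ?thesis by blast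
  qed
  then have "h holomorphic_on UNIV"
    unfolding holomorphic_on_def
    by (metis centre_in_ball at_within_open field_differentiable_at_within open_ball)
  moreover have "G z = h z * P z" for z
    using zeros by (auto simp: h_def)
  ultimately show ?thesis by blast
qed

text \<open>Simple zeros are isolated, so continuity of \<open>D\<close> covers them. With
  \<open>D z = h (z + \<omega>) - h z\<close> this carries periodicity of \<open>h\<close> across
  the zeros of \<open>P\<close>.\<close>

lemma mult_simple_zeros_eq_0:
  fixes D P :: "complex \<Rightarrow> complex"
  assumes D: "continuous_on UNIV D" and P: "P holomorphic_on UNIV"
    and zeros: "\<And>w. P w = 0 \<Longrightarrow> deriv P w \<noteq> 0"
    and DP: "\<And>z. D z * P z = 0"
  shows "D w = 0"
proof (cases "P w = 0")
  case False
  with DP[of w] show ?thesis by simp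
next
  case True
  have "((\<lambda>z. (P z - P w) / (z - w)) \<longlongrightarrow> deriv P w) (at w)"
    using holomorphic_derivI[OF P, of w] by (simp add: has_field_derivative_iff)
  then have "\<forall>\<^sub>F z in at w. (P z - P w) / (z - w) \<noteq> 0"
    using zeros[OF True] tendsto_imp_eventually_ne by blast
  then have "\<forall>\<^sub>F z in at w. D z = 0"
    by eventually_elim (use DP True in auto)
  then have "(D \<longlongrightarrow> 0) (at w)"
    by (rule tendsto_eventually)
  moreover have "(D \<longlongrightarrow> D w) (at w)"
    using D by (auto simp: continuous_on_def)
  ultimately show ?thesis
    using tendsto_unique[OF trivial_limit_at] by blast
qed

lemma periodic_of_int:
  fixes h :: "complex \<Rightarrow> 'a"
  assumes "\<And>z. h (z + \<omega>) = h z"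
  shows "h (z + of_int n * \<omega>) = h z"
proof (induction n rule: int_induct[where k = 0])
  case (step1 i)
  then show ?case using assms[of "z + of_int i * \<omega>"] by (simp add: algebra_simps)
next
  case (step2 i)
  then show ?case using assms[of "z + of_int (i - 1) * \<omega>"] by (simp add: algebra_simps)
qed auto

text \<open>Reduction modulo the lattice moves every point into a compact parallelogram, so
  \<open>h\<close> is bounded and Liouville's theorem applies.\<close>

lemma doubly_periodic_entire_constant:
  assumes h: "h holomorphic_on UNIV" and \<tau>: "Im \<tau> > 0"
    and per: "\<And>z. h (z + 1) = h z" "\<And>z. h (z + \<tau>) = h z"
  shows "\<exists>c. \<forall>z. h z = c"
proof -
  define cell where "cell = (\<lambda>(s, t). of_real s + of_real t * \<tau>) ` ({0..1} \<times> {0..1::real})"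
  have "compact cell"
    unfolding cell_def case_prod_unfold
    by (intro compact_continuous_image continuous_intros compact_Times) auto
  then have "bounded (h ` cell)"
    by (intro compact_imp_bounded compact_continuous_image holomorphic_on_imp_continuous_on
        holomorphic_on_subset[OF h]) auto
  moreover have "range h \<subseteq> h ` cell"
  proof safe
    fix z
    define t where "t = Im z / Im \<tau>"
    define s where "s = Re z - t * Re \<tau>"
    have z: "z = of_real s + of_real t * \<tau>"
      using \<tau> by (simp add: complex_eq_iff s_def t_def)
    have "h z = h (z + of_int (- \<lfloor>s\<rfloor>) * 1 + of_int (- \<lfloor>t\<rfloor>) * \<tau>)"
      by (simp only: periodic_of_int[of h, OF per(1)] periodic_of_int[of h, OF per(2)])
    also have "z + of_int (- \<lfloor>s\<rfloor>) * 1 + of_int (- \<lfloor>t\<rfloor>) * \<tau> = of_real (frac s) + of_real (frac t) * \<tau>"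
      unfolding z frac_def by (simp add: algebra_simps)
    finally show "h z \<in> h ` cell"
      unfolding cell_def using frac_lt_1 frac_ge_0 by (force intro: less_imp_le)
  qed
  ultimately have "bounded (range h)"
    using bounded_subset by blast
  then show ?thesis
    using Liouville_theorem[OF h] by (auto simp: constant_on_def)
qed

text \<open>The common multiplier \<open>b\<close> cancels in \<open>G / P\<close>, which is entire
  because the zeros of \<open>P\<close> are simple and shared by \<open>G\<close>; the quotient is
  doubly periodic, hence constant.\<close>

lemma quasi_periodic_entire_proportional:
  assumes P: "P holomorphic_on UNIV" and G: "G holomorphic_on UNIV"
    and zeros: "\<And>w. P w = 0 \<Longrightarrow> G w = 0 \<and> deriv P w \<noteq> 0" and \<tau>: "Im \<tau> > 0"
    and per1: "\<And>z. P (z + 1) = P z" "\<And>z. G (z + 1) = G z"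
    and per2: "\<And>z. P (z + \<tau>) = b z * P z" "\<And>z. G (z + \<tau>) = b z * G z" "\<And>z. b z \<noteq> 0"
  shows "\<exists>c. \<forall>z. G z = c * P z"
proof -
  obtain h where h: "h holomorphic_on UNIV" "\<And>z. G z = h z * P z"
    using entire_quotient[OF P G zeros] by blast
  have cont: "continuous_on UNIV (\<lambda>z. h (z + \<omega>) - h z)" for \<omega>
    using holomorphic_on_imp_continuous_on[OF h(1)]
    by (auto intro!: continuous_intros intro: continuous_on_compose2)
  have "h (z + 1) - h z = 0" for z
  proof (rule mult_simple_zeros_eq_0[OF cont P])
    show "(h (z + 1) - h z) * P z = 0" for z
      using per1[of z] h(2)[of z] h(2)[of "z + 1"] by (simp add: left_diff_distrib)
  qed (use zeros in auto)
  moreover have "h (z + \<tau>) - h z = 0" for z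
  proof (rule mult_simple_zeros_eq_0[OF cont P])
    show "(h (z + \<tau>) - h z) * P z = 0" for z
    proof -
      have "b z * ((h (z + \<tau>) - h z) * P z) = 0"
        using per2(1,2)[of z] h(2)[of z] h(2)[of "z + \<tau>"] by (auto simp: algebra_simps)
      with per2(3)[of z] show ?thesis by simp
    qed
  qed (use zeros in auto)
  ultimately obtain c where "\<And>z. h z = c"
    using doubly_periodic_entire_constant[OF h(1) \<tau>] by fastforce
  with h(2) show ?thesis by auto
qed

section \<open>The theta product and its inversion formula\<close>

text \<open>Scaled by \<pi> \<i> and not by 2 \<pi> \<i>, so that \<open>expi \<tau>\<close> is the
  nome and a shift by 1 is a change of sign.\<close>

definition expi :: "complex \<Rightarrow> complex" where
  "expi z = exp (of_real pi * \<i> * z)"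

lemma expi_add: "expi (a + b) = expi a * expi b"
  by (simp add: expi_def exp_add algebra_simps)

lemma expi_0 [simp]: "expi 0 = 1"
  by (simp add: expi_def)

lemma expi_1 [simp]: "expi 1 = - 1"
  by (simp add: expi_def mult.commute)

lemma expi_nonzero [simp]: "expi z \<noteq> 0"
  by (simp add: expi_def)

lemma expi_power: "expi z ^ n = expi (of_nat n * z)"
  by (simp add: expi_def flip: exp_of_nat_mult) (simp add: algebra_simps)

lemma expi_eq_1_iff: "expi z = 1 \<longleftrightarrow> (\<exists>n::int. z = of_int (2 * n))"
proof -
  have "expi z = 1 \<longleftrightarrow> Im z = 0 \<and> (\<exists>n::int. Re z = of_int (2 * n))"
    unfolding expi_def exp_eq_1 by (auto simp: algebra_simps)
  then show ?thesis
    by (auto simp: complex_eq_iff)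
qed

lemma one_plus_expi_eq_0_iff: "1 + expi z = 0 \<longleftrightarrow> (\<exists>n::int. z = of_int (2 * n - 1))"
proof -
  have "1 + expi z = 0 \<longleftrightarrow> expi (z + 1) = 1"
    by (auto simp: expi_add add_eq_0_iff minus_equation_iff[of _ 1])
  then show ?thesis
    by (simp add: expi_eq_1_iff algebra_simps eq_diff_eq)
qed

lemma expi_add_1: "expi (z + 1) = - expi z"
  by (simp add: expi_add)

lemma expi_add_2: "expi (z + 2) = expi z"
  using expi_add_1[of z] expi_add_1[of "z + 1"] by (simp add: add.assoc)

lemma norm_expi: "norm (expi z) = exp (- pi * Im z)"
  by (simp add: expi_def)

lemma norm_expi_less_1: "Im z > 0 \<Longrightarrow> norm (expi z) < 1"
  by (simp add: norm_expi)

lemma norm_expi_double_less_1: "Im z > 0 \<Longrightarrow> norm (expi (2 * z)) < 1"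
  by (simp add: norm_expi)

lemma holomorphic_expi [holomorphic_intros]:
  "f holomorphic_on S \<Longrightarrow> (\<lambda>z. expi (f z)) holomorphic_on S"
  unfolding expi_def by (intro holomorphic_intros)

text \<open>Up to a factor depending only on \<open>\<tau>\<close>, this is the Jacobi theta function
  \<open>\<Sum>n\<in>\<int>. exp (\<pi> \<i> n\<^sup>2 \<tau> + 2 \<pi> \<i> n z)\<close>, by the triple product identity.\<close>

definition theta_prod :: "complex \<Rightarrow> complex \<Rightarrow> complex" where
  "theta_prod \<tau> z =
     qpoch (expi (\<tau> + 2 * z)) (expi (2 * \<tau>)) * qpoch (expi (\<tau> - 2 * z)) (expi (2 * \<tau>))"

section \<open>Quasi-periodicity and zeros of the theta product\<close>

lemma holomorphic_theta_prod:
  assumes "Im \<tau> > 0" "f holomorphic_on UNIV"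
  shows "(\<lambda>z. theta_prod \<tau> (f z)) holomorphic_on UNIV"
  unfolding theta_prod_def using norm_expi_double_less_1[OF assms(1)]
  by (intro holomorphic_intros assms) auto

lemma theta_prod_add_1: "theta_prod \<tau> (z + 1) = theta_prod \<tau> z"
proof -
  have "expi (\<tau> + 2 * (z + 1)) = expi (\<tau> + 2 * z)"
    using expi_add_2[of "\<tau> + 2 * z"] by (simp add: algebra_simps)
  moreover have "expi (\<tau> - 2 * (z + 1)) = expi (\<tau> - 2 * z)"
    using expi_add_2[of "\<tau> - 2 * (z + 1)"] by (simp add: algebra_simps)
  ultimately show ?thesis
    by (simp add: theta_prod_def)
qed

text \<open>With \<open>a' = 1 / a\<close>, the shift removes the head factor \<open>1 + a\<close>
  from the first product and adds the head factor \<open>1 + a'\<close> to the second; their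
  quotient is \<open>a'\<close>.\<close>

lemma theta_prod_add_tau:
  assumes "Im \<tau> > 0"
  shows "theta_prod \<tau> (z + \<tau>) = expi (- \<tau> - 2 * z) * theta_prod \<tau> z"
proof -
  define q a where "q = expi (2 * \<tau>)" and "a = expi (\<tau> + 2 * z)"
  define a' where "a' = expi (- \<tau> - 2 * z)"
  have q: "norm q < 1"
    unfolding q_def using assms by (rule norm_expi_double_less_1)
  have aa': "a' * a = 1"
    by (simp add: a_def a'_def flip: expi_add)
  have 1: "expi (\<tau> + 2 * (z + \<tau>)) = a * q" "expi (\<tau> - 2 * (z + \<tau>)) = a'" "expi (\<tau> - 2 * z) = a' * q"
    by (simp_all add: a_def a'_def q_def algebra_simps flip: expi_add)
  have "theta_prod \<tau> (z + \<tau>) = qpoch (a * q) q * ((1 + a') * qpoch (a' * q) q)"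
    unfolding theta_prod_def 1 q_def[symmetric] using qpoch_head[OF q, of a'] by simp
  also have "\<dots> = a' * ((1 + a) * qpoch (a * q) q * qpoch (a' * q) q)"
  proof -
    have "1 + a' = a' * (1 + a)"
      using aa' by (simp add: distrib_left)
    then show ?thesis by (simp only: ac_simps)
  qed
  also have "\<dots> = a' * theta_prod \<tau> z"
    unfolding theta_prod_def 1 q_def[symmetric] a_def[symmetric] using qpoch_head[OF q, of a] by simp
  finally show ?thesis
    by (simp add: a'_def)
qed

lemma theta_prod_eq_0_iff:
  assumes "Im \<tau> > 0"
  shows "theta_prod \<tau> z = 0 \<longleftrightarrow> (\<exists>m n::int. 2 * z = of_int (2 * m + 1) + of_int (2 * n + 1) * \<tau>)"
proof -
  have q: "norm (expi (2 * \<tau>)) < 1"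
    using assms by (rule norm_expi_double_less_1)
  have eq: "1 + expi w * expi (2 * \<tau>) ^ n = 0 \<longleftrightarrow> (\<exists>m::int. w + of_nat n * (2 * \<tau>) = of_int (2 * m - 1))" for w n
    unfolding expi_power expi_add[symmetric] one_plus_expi_eq_0_iff ..
  have "theta_prod \<tau> z = 0 \<longleftrightarrow>
      (\<exists>(n::nat) (m::int). \<tau> + 2 * z + of_nat n * (2 * \<tau>) = of_int (2 * m - 1)) \<or>
      (\<exists>(n::nat) (m::int). \<tau> - 2 * z + of_nat n * (2 * \<tau>) = of_int (2 * m - 1))"
    unfolding theta_prod_def mult_eq_0_iff qpoch_eq_0_iff[OF q] eq ..
  also have "\<dots> \<longleftrightarrow> (\<exists>m n::int. 2 * z = of_int (2 * m + 1) + of_int (2 * n + 1) * \<tau>)"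
  proof safe
    fix n m assume "\<tau> + 2 * z + of_nat n * (2 * \<tau>) = of_int (2 * m - 1)"
    then have "2 * z = of_int (2 * (m - 1) + 1) + of_int (2 * (- int n - 1) + 1) * \<tau>"
      by (simp add: algebra_simps)
    then show "\<exists>m n::int. 2 * z = of_int (2 * m + 1) + of_int (2 * n + 1) * \<tau>"
      by blast
  next
    fix n m assume "\<tau> - 2 * z + of_nat n * (2 * \<tau>) = of_int (2 * m - 1)"
    then have "2 * z = of_int (2 * (- m) + 1) + of_int (2 * (int n) + 1) * \<tau>"
      by (simp add: algebra_simps)
    then show "\<exists>m n::int. 2 * z = of_int (2 * m + 1) + of_int (2 * n + 1) * \<tau>"
      by blast
  next
    fix m n :: int
    assume z: "2 * z = of_int (2 * m + 1) + of_int (2 * n + 1) * \<tau>"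
      and no: "\<nexists>(n::nat) (m::int). \<tau> - 2 * z + of_nat n * (2 * \<tau>) = of_int (2 * m - 1)"
    show "\<exists>(n::nat) (m::int). \<tau> + 2 * z + of_nat n * (2 * \<tau>) = of_int (2 * m - 1)"
    \<comment> \<open>Zeros with \<open>n \<ge> 0\<close> come from the second product, those with
      \<open>n < 0\<close> from the first, at the factor with index \<open>- n - 1\<close>.\<close>
    proof (cases "n \<ge> 0")
      case True
      then have "\<tau> - 2 * z + of_nat (nat n) * (2 * \<tau>) = of_int (2 * (- m) - 1)"
        unfolding z by (simp add: algebra_simps)
      with no show ?thesis by blast
    next
      case False
      then have "\<tau> + 2 * z + of_nat (nat (- n - 1)) * (2 * \<tau>) = of_int (2 * (m + 1) - 1)"
        unfolding z by (simp add: algebra_simps)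
      then show ?thesis by blast
    qed
  qed
  finally show ?thesis .
qed

lemma deriv_theta_prod_base:
  assumes "Im \<tau> > 0"
  shows "deriv (theta_prod \<tau>) ((1 + \<tau>) / 2) \<noteq> 0"
proof -
  define q where "q = expi (2 * \<tau>)"
  have q: "norm q < 1"
    unfolding q_def using assms by (rule norm_expi_double_less_1)
  define z0 where "z0 = (1 + \<tau>) / 2"
  \<comment> \<open>At \<open>z0\<close> only the head factor of the second product vanishes;
    \<open>R\<close> collects all the others.\<close>
  define R where "R z = qpoch (expi (\<tau> + 2 * z)) q * qpoch (expi (\<tau> - 2 * z) * q) q" for z
  have "R holomorphic_on UNIV"
    unfolding R_def by (intro holomorphic_intros q) auto
  then have R: "(R has_field_derivative deriv R z0) (at z0)"
    by (rule holomorphic_derivI) auto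
  have eq: "theta_prod \<tau> = (\<lambda>z. (1 + expi (\<tau> - 2 * z)) * R z)"
    unfolding theta_prod_def R_def q_def[symmetric]
    by (rule ext, subst qpoch_head[OF q, of "expi (\<tau> - 2 * _)"]) (simp add: algebra_simps)
  have E: "\<tau> - 2 * z0 = - 1" "expi (- 1) = - 1" "\<tau> + 2 * z0 = 2 * \<tau> + 1"
    using expi_add_1[of "-1"] by (simp_all add: z0_def field_simps minus_equation_iff[of _ 1])
  have "((\<lambda>z. 1 + expi (\<tau> - 2 * z)) has_field_derivative
      expi (\<tau> - 2 * z0) * (of_real pi * \<i> * (- 2))) (at z0)"
    unfolding expi_def by (auto intro!: derivative_eq_intros)
  from DERIV_mult[OF this R]
  have "(theta_prod \<tau> has_field_derivative (of_real pi * \<i> * 2) * R z0) (at z0)"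
    unfolding eq E by (simp add: E)
  then have "deriv (theta_prod \<tau>) z0 = (of_real pi * \<i> * 2) * R z0"
    by (rule DERIV_imp_deriv)
  moreover have "R z0 \<noteq> 0"
  proof -
    have "R z0 = qpoch (- q) q * qpoch (- q) q"
      by (simp add: R_def E expi_add_1 q_def)
    with qpoch_euler_nonzero[OF q refl] show ?thesis by simp
  qed
  ultimately show ?thesis
    by (simp add: z0_def)
qed

text \<open>Translating by a period multiplies a quasi-periodic function by a nonvanishing factor,
  so it preserves the order of a zero.\<close>

lemma deriv_theta_prod_nonzero:
  assumes \<tau>: "Im \<tau> > 0" and z: "theta_prod \<tau> z = 0"
  shows "deriv (theta_prod \<tau>) z \<noteq> 0"
proof -
  let ?F = "theta_prod \<tau>"
  have hol: "?F holomorphic_on UNIV"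
    using holomorphic_theta_prod[OF \<tau> holomorphic_on_id] by simp
  note D = holomorphic_derivI[OF hol open_UNIV UNIV_I]
  have per1: "deriv ?F (w + 1) = deriv ?F w" for w
  proof -
    have "((\<lambda>z. ?F (z + 1)) has_field_derivative deriv ?F (w + 1)) (at w)"
      using DERIV_shift[of ?F "deriv ?F (w + 1)" w 1] D[of "w + 1"] by simp
    then show ?thesis
      unfolding theta_prod_add_1 by (simp add: DERIV_imp_deriv)
  qed
  \<comment> \<open>The derivative of the multiplier comes with the factor \<open>?F w\<close>,
    which is 0 here.\<close>
  have per\<tau>: "deriv ?F (w + \<tau>) = expi (- \<tau> - 2 * w) * deriv ?F w" if "?F w = 0" for w
  proof -
    have "((\<lambda>z. expi (- \<tau> - 2 * z)) has_field_derivative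
        expi (- \<tau> - 2 * w) * (of_real pi * \<i> * (- 2))) (at w)"
      unfolding expi_def by (auto intro!: derivative_eq_intros)
    from DERIV_mult[OF this D[of w]]
    have "((\<lambda>z. ?F (z + \<tau>)) has_field_derivative expi (- \<tau> - 2 * w) * deriv ?F w) (at w)"
      unfolding theta_prod_add_tau[OF \<tau>] by (simp add: that mult.commute)
    moreover have "((\<lambda>z. ?F (z + \<tau>)) has_field_derivative deriv ?F (w + \<tau>)) (at w)"
      using DERIV_shift[of ?F "deriv ?F (w + \<tau>)" w \<tau>] D[of "w + \<tau>"] by simp
    ultimately show ?thesis
      using DERIV_unique by blast
  qed
  obtain m n :: int where mn: "2 * z = of_int (2 * m + 1) + of_int (2 * n + 1) * \<tau>"
    using z theta_prod_eq_0_iff[OF \<tau>] by blast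
  have zero: "?F ((1 + \<tau>) / 2 + of_int n * \<tau>) = 0" for n
    unfolding theta_prod_eq_0_iff[OF \<tau>]
    by (rule exI[of _ 0], rule exI[of _ n]) (simp add: field_simps)
  \<comment> \<open>All zeros are translates of \<open>(1 + \<tau>) / 2\<close>: the induction
    handles multiples of \<tau>, periodicity then those of 1.\<close>
  have "deriv ?F ((1 + \<tau>) / 2 + of_int n * \<tau>) \<noteq> 0"
  proof (induction n rule: int_induct[where k = 0])
    case base
    then show ?case using deriv_theta_prod_base[OF \<tau>] by simp
  next
    case (step1 i)
    then show ?case using per\<tau>[OF zero[of i]] by (simp add: algebra_simps)
  next
    case (step2 i)
    then show ?case using per\<tau>[OF zero[of "i - 1"]] by (simp add: algebra_simps)
  qed
  moreover have "z = (1 + \<tau>) / 2 + of_int n * \<tau> + of_int m * 1"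
    using mn by (simp add: field_simps)
  ultimately show ?thesis
    using periodic_of_int[of "deriv ?F", OF per1] by metis
qed

text \<open>The Gaussian factor matches the multipliers of the two sides: adding 1 to
  \<open>z\<close> shifts \<open>z / \<tau>\<close> by minus the quasi-period
  \<open>- 1 / \<tau>\<close>, and adding \<tau> shifts it by 1. The factor \<open>c\<close> may
  depend on \<tau> and stays undetermined.\<close>

lemma theta_prod_inversion:
  assumes \<tau>: "Im \<tau> > 0"
  shows "\<exists>c. \<forall>z. expi (- z\<^sup>2 / \<tau>) * theta_prod (- 1 / \<tau>) (z / \<tau>) = c * theta_prod \<tau> z"
proof (rule quasi_periodic_entire_proportional[where b = "\<lambda>z. expi (- \<tau> - 2 * z)"])
  let ?t = "- 1 / \<tau>"
  have [simp]: "\<tau> \<noteq> 0" using \<tau> by auto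
  have t: "Im ?t > 0"
    using \<tau> by (simp add: Im_divide add_nonneg_pos)
  show "theta_prod \<tau> holomorphic_on UNIV"
    using holomorphic_theta_prod[OF \<tau> holomorphic_on_id] by simp
  show "(\<lambda>z. expi (- z\<^sup>2 / \<tau>) * theta_prod ?t (z / \<tau>)) holomorphic_on UNIV"
    by (intro holomorphic_intros holomorphic_theta_prod t) auto
  show "expi (- (z + 1)\<^sup>2 / \<tau>) * theta_prod ?t ((z + 1) / \<tau>) = expi (- z\<^sup>2 / \<tau>) * theta_prod ?t (z / \<tau>)" for z
  proof -
    have "theta_prod ?t (z / \<tau>) = expi (- ?t - 2 * ((z + 1) / \<tau>)) * theta_prod ?t ((z + 1) / \<tau>)"
      using theta_prod_add_tau[OF t, of "(z + 1) / \<tau>"] by (simp add: field_simps)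
    moreover have "- z\<^sup>2 / \<tau> + (- ?t - 2 * ((z + 1) / \<tau>)) = - (z + 1)\<^sup>2 / \<tau>"
      by (simp add: field_simps power2_eq_square)
    ultimately show ?thesis
      by (metis expi_add mult.assoc)
  qed
  show "expi (- (z + \<tau>)\<^sup>2 / \<tau>) * theta_prod ?t ((z + \<tau>) / \<tau>) =
      expi (- \<tau> - 2 * z) * (expi (- z\<^sup>2 / \<tau>) * theta_prod ?t (z / \<tau>))" for z
  proof -
    have "- (z + \<tau>)\<^sup>2 / \<tau> = (- \<tau> - 2 * z) + - z\<^sup>2 / \<tau>"
      by (simp add: field_simps power2_eq_square)
    moreover have "(z + \<tau>) / \<tau> = z / \<tau> + 1"
      by (simp add: field_simps)
    ultimately show ?thesis
      by (simp only: expi_add theta_prod_add_1 mult.assoc)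
  qed
  show "expi (- w\<^sup>2 / \<tau>) * theta_prod ?t (w / \<tau>) = 0 \<and> deriv (theta_prod \<tau>) w \<noteq> 0"
    if w: "theta_prod \<tau> w = 0" for w
  proof
    obtain m n :: int where mn: "2 * w = of_int (2 * m + 1) + of_int (2 * n + 1) * \<tau>"
      using w theta_prod_eq_0_iff[OF \<tau>] by blast
    \<comment> \<open>Division by \<tau> exchanges the roles of \<open>m\<close> and
      \<open>n\<close>.\<close>
    then have "2 * (w / \<tau>) = of_int (2 * n + 1) + of_int (2 * (- m - 1) + 1) * ?t"
      by (simp add: field_simps)
    then have "theta_prod ?t (w / \<tau>) = 0"
      unfolding theta_prod_eq_0_iff[OF t] by blast
    then show "expi (- w\<^sup>2 / \<tau>) * theta_prod ?t (w / \<tau>) = 0" by simp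
    show "deriv (theta_prod \<tau>) w \<noteq> 0"
      by (rule deriv_theta_prod_nonzero[OF \<tau> w])
  qed
qed (use \<tau> theta_prod_add_1 theta_prod_add_tau in auto)

section \<open>Transformation of the Weber functions\<close>

lemma zeta_eq_expi: "zeta k = expi (2 / of_nat k)"
  by (simp add: zeta_def expi_def field_simps)

section \<open>Product expansions of the Weber functions\<close>

lemma norm_nome: "Im \<tau> > 0 \<Longrightarrow> norm (expi \<tau>) < 1" "Im \<tau> > 0 \<Longrightarrow> norm ((expi \<tau>)\<^sup>2) < 1"
  using norm_expi_less_1 norm_power2_less_1 by blast+

lemma dedekind_eta_eq: "dedekind_eta \<tau> = expi (\<tau> / 12) * qpoch (- (expi \<tau>)\<^sup>2) ((expi \<tau>)\<^sup>2)"
proof -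
  have "exp (2 * of_real pi * \<i> * \<tau>) = (expi \<tau>)\<^sup>2"
    by (simp add: expi_power) (simp add: expi_def algebra_simps)
  moreover have "exp (2 * of_real pi * \<i> * \<tau> / 24) = expi (\<tau> / 12)"
    by (simp add: expi_def algebra_simps)
  ultimately show ?thesis
    by (simp add: dedekind_eta_def qpoch_def)
qed

text \<open>Halving \<tau> replaces the square of the nome by the nome. The factors with even powers
  of the nome form the product in \<open>dedekind_eta \<tau>\<close> and cancel; the odd powers
  remain.\<close>

lemma weber_f1_eq:
  assumes "Im \<tau> > 0"
  shows "weber_f1 \<tau> = expi (- \<tau> / 24) * qpoch (- expi \<tau>) ((expi \<tau>)\<^sup>2)"
proof -
  let ?x = "expi \<tau>"
  have "expi (\<tau> / 2) ^ 2 = ?x"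
    by (simp add: expi_power)
  then have "dedekind_eta (\<tau> / 2) = expi (\<tau> / 24) * qpoch (- ?x) ?x"
    by (simp add: dedekind_eta_eq)
  also have "qpoch (- ?x) ?x = qpoch (- ?x) (?x\<^sup>2) * qpoch (- ?x\<^sup>2) (?x\<^sup>2)"
    using qpoch_split[OF norm_nome(1)[OF assms], of "- ?x"] by (simp add: power2_eq_square)
  finally have "weber_f1 \<tau> = expi (\<tau> / 24) / expi (\<tau> / 12) * qpoch (- ?x) (?x\<^sup>2)"
    using qpoch_euler_nonzero[OF norm_nome(2)[OF assms] refl]
    by (simp add: weber_f1_def dedekind_eta_eq field_simps)
  also have "expi (\<tau> / 24) = expi (- \<tau> / 24) * expi (\<tau> / 12)"
    by (simp flip: expi_add)
  finally show ?thesis by simp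
qed

lemma weber_f_eq:
  assumes "Im \<tau> > 0"
  shows "weber_f \<tau> = expi (- \<tau> / 24) * qpoch (expi \<tau>) ((expi \<tau>)\<^sup>2)"
proof -
  let ?x = "expi \<tau>"
  have x: "norm (- ?x) < 1"
    using norm_nome(1)[OF assms] by simp
  \<comment> \<open>The shift by 1 replaces the nome by its negative, so only the odd powers change
    sign.\<close>
  have "expi ((\<tau> + 1) / 2) ^ 2 = expi (\<tau> + 1)"
    unfolding expi_power by (rule arg_cong[where f = expi]) simp
  then have "expi ((\<tau> + 1) / 2) ^ 2 = - ?x"
    by (simp only: expi_add_1)
  then have "dedekind_eta ((\<tau> + 1) / 2) = expi ((\<tau> + 1) / 24) * qpoch ?x (- ?x)"
    by (simp add: dedekind_eta_eq)
  also have "qpoch ?x (- ?x) = qpoch ?x (?x\<^sup>2) * qpoch (- ?x\<^sup>2) (?x\<^sup>2)"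
    using qpoch_split[OF x, of ?x] by (simp add: power2_eq_square)
  finally have "weber_f \<tau> = expi ((\<tau> + 1) / 24) / (zeta 48 * expi (\<tau> / 12)) * qpoch ?x (?x\<^sup>2)"
    using qpoch_euler_nonzero[OF norm_nome(2)[OF assms] refl]
    by (simp add: weber_f_def dedekind_eta_eq field_simps)
  also have "expi ((\<tau> + 1) / 24) = expi (- \<tau> / 24) * (zeta 48 * expi (\<tau> / 12))"
    by (simp add: zeta_eq_expi flip: expi_add) (simp add: field_simps)
  finally show ?thesis by (simp add: zeta_eq_expi)
qed

lemma weber_f2_eq:
  assumes "Im \<tau> > 0"
  shows "weber_f2 \<tau> = of_real (sqrt 2) * expi (\<tau> / 12) * qpoch ((expi \<tau>)\<^sup>2) ((expi \<tau>)\<^sup>2)"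
proof -
  let ?q = "(expi \<tau>)\<^sup>2"
  have "expi (2 * \<tau>) = ?q"
    by (simp add: expi_power)
  then have "dedekind_eta (2 * \<tau>) = expi (\<tau> / 6) * qpoch (- ?q\<^sup>2) (?q\<^sup>2)"
    by (simp add: dedekind_eta_eq)
  also have "qpoch (- ?q\<^sup>2) (?q\<^sup>2) = qpoch ?q ?q * qpoch (- ?q) ?q"
    by (rule qpoch_mult_minus[OF norm_nome(2)[OF assms], symmetric])
  finally have "weber_f2 \<tau> = of_real (sqrt 2) * (expi (\<tau> / 6) / expi (\<tau> / 12)) * qpoch ?q ?q"
    using qpoch_euler_nonzero[OF norm_nome(2)[OF assms] refl]
    by (simp add: weber_f2_def dedekind_eta_eq field_simps)
  also have "expi (\<tau> / 6) = expi (\<tau> / 12) * expi (\<tau> / 12)"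
    by (simp flip: expi_add)
  finally show ?thesis by simp
qed

text \<open>Factor \<open>1 - x ^ (2 * n) = (1 - x ^ n) * (1 + x ^ n)\<close> and separate even from
  odd powers: Euler's product becomes itself times the three Weber products, which therefore
  multiply to 1.\<close>

lemma weber_product:
  assumes "Im \<tau> > 0"
  shows "weber_f \<tau> * weber_f1 \<tau> * weber_f2 \<tau> = of_real (sqrt 2)"
proof -
  let ?x = "expi \<tau>"
  note x = norm_nome(1)[OF assms]
  have ne: "qpoch (- ?x\<^sup>2) (?x\<^sup>2) \<noteq> 0"
    by (rule qpoch_euler_nonzero[OF norm_nome(2)[OF assms] refl])
  have "qpoch ?x ?x = qpoch ?x (?x\<^sup>2) * qpoch (?x\<^sup>2) (?x\<^sup>2)"
    using qpoch_split[OF x, of ?x] by (simp add: power2_eq_square)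
  moreover have "qpoch (- ?x) ?x = qpoch (- ?x) (?x\<^sup>2) * qpoch (- ?x\<^sup>2) (?x\<^sup>2)"
    using qpoch_split[OF x, of "- ?x"] by (simp add: power2_eq_square)
  moreover have "qpoch ?x ?x * qpoch (- ?x) ?x = qpoch (- ?x\<^sup>2) (?x\<^sup>2)"
    by (rule qpoch_mult_minus[OF x])
  ultimately have "qpoch ?x (?x\<^sup>2) * qpoch (- ?x) (?x\<^sup>2) * qpoch (?x\<^sup>2) (?x\<^sup>2) = 1"
    using ne by (simp add: field_simps)
  moreover have "expi (- \<tau> / 24) * expi (- \<tau> / 24) * expi (\<tau> / 12) = 1"
    by (simp flip: expi_add)
  moreover have "weber_f \<tau> * weber_f1 \<tau> * weber_f2 \<tau> = of_real (sqrt 2) *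
      (expi (- \<tau> / 24) * expi (- \<tau> / 24) * expi (\<tau> / 12)) *
      (qpoch ?x (?x\<^sup>2) * qpoch (- ?x) (?x\<^sup>2) * qpoch (?x\<^sup>2) (?x\<^sup>2))"
    unfolding weber_f_eq[OF assms] weber_f1_eq[OF assms] weber_f2_eq[OF assms] by (simp only: ac_simps)
  ultimately show ?thesis by simp
qed

lemma weber_nonzero:
  assumes "Im \<tau> > 0"
  shows "weber_f \<tau> \<noteq> 0" "weber_f1 \<tau> \<noteq> 0" "weber_f2 \<tau> \<noteq> 0"
  using weber_product[OF assms] by auto

lemma weber_add_1:
  assumes "Im \<tau> > 0"
  shows "weber_f (\<tau> + 1) = expi (- 1 / 24) * weber_f1 \<tau>"
    "weber_f1 (\<tau> + 1) = expi (- 1 / 24) * weber_f \<tau>"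
    "weber_f2 (\<tau> + 1) = expi (1 / 12) * weber_f2 \<tau>"
proof -
  have t: "Im (\<tau> + 1) > 0" using assms by simp
  have 1: "- (\<tau> + 1) / 24 = - 1 / 24 + - \<tau> / 24" "(\<tau> + 1) / 12 = 1 / 12 + \<tau> / 12"
    by (simp_all add: field_simps)
  show "weber_f (\<tau> + 1) = expi (- 1 / 24) * weber_f1 \<tau>"
    "weber_f1 (\<tau> + 1) = expi (- 1 / 24) * weber_f \<tau>"
    "weber_f2 (\<tau> + 1) = expi (1 / 12) * weber_f2 \<tau>"
    unfolding weber_f_eq[OF assms] weber_f1_eq[OF assms] weber_f2_eq[OF assms]
      weber_f_eq[OF t] weber_f1_eq[OF t] weber_f2_eq[OF t] 1 expi_add
    by simp_all
qed

section \<open>Inversion of the Weber functions up to a sixth root of unity\<close>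

lemma Im_inversion: "Im \<tau> > 0 \<Longrightarrow> Im (- 1 / \<tau>) > 0"
  by (simp add: Im_divide add_nonneg_pos)

text \<open>The inversion formula at \<open>z = 0\<close> and at the half period
  \<open>z = 1 / 2\<close> contains the same unknown \<open>c\<close>, which cancels on
  cross-multiplying. The first value involves \<open>weber_f\<close> only; the second links
  \<open>weber_f1\<close> at \<tau> to \<open>weber_f2\<close> at
  \<open>- 1 / \<tau>\<close>.\<close>

lemma weber_inversion_ratio:
  assumes \<tau>: "Im \<tau> > 0"
  shows "weber_f2 (- 1 / \<tau>) ^ 2 * weber_f \<tau> ^ 2 = weber_f1 \<tau> ^ 2 * weber_f (- 1 / \<tau>) ^ 2"
proof -
  define t where "t = - 1 / \<tau>"
  have t: "Im t > 0" unfolding t_def using \<tau> by (rule Im_inversion)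
  have [simp]: "\<tau> \<noteq> 0" using \<tau> by auto
  have q: "expi (2 * w) = (expi w)\<^sup>2" for w by (simp add: expi_power)
  have n: "expi (w - 1) = - expi w" for w using expi_add_1[of "w - 1"] by simp
  define F0 F1 F2 where "F0 = (\<lambda>w. qpoch (expi w) ((expi w)\<^sup>2))"
    and "F1 = (\<lambda>w. qpoch (- expi w) ((expi w)\<^sup>2))" and "F2 = (\<lambda>w. qpoch ((expi w)\<^sup>2) ((expi w)\<^sup>2))"
  obtain c where c: "\<And>z. expi (- z\<^sup>2 / \<tau>) * theta_prod t (z / \<tau>) = c * theta_prod \<tau> z"
    using theta_prod_inversion[OF \<tau>] unfolding t_def by blast
  have 0: "F0 t ^ 2 = c * F0 \<tau> ^ 2"
    using c[of 0] by (simp add: theta_prod_def F0_def q power2_eq_square)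
  have "theta_prod \<tau> (1 / 2) = F1 \<tau> ^ 2"
    by (simp add: theta_prod_def F1_def q n expi_add_1 power2_eq_square)
  moreover have "theta_prod t (1 / 2 / \<tau>) = 2 * F2 t ^ 2"
  proof -
    have args: "t + 2 * (1 / 2 / \<tau>) = 0" "t - 2 * (1 / 2 / \<tau>) = 2 * t"
      by (simp_all add: t_def field_simps)
    then have "theta_prod t (1 / 2 / \<tau>) = qpoch 1 (expi (2 * t)) * F2 t"
      by (simp only: theta_prod_def F2_def args q expi_0)
    \<comment> \<open>The head factor \<open>1 + 1 = 2\<close> matches the square of the constant
      \<open>sqrt 2\<close> in \<open>weber_f2\<close>.\<close>
    also have "qpoch 1 (expi (2 * t)) = 2 * F2 t"
      using qpoch_head[of "expi (2 * t)" 1] norm_nome(2)[OF t] unfolding q F2_def by simp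
    finally show ?thesis by (simp only: power2_eq_square mult.assoc)
  qed
  moreover have "- (1 / 2)\<^sup>2 / \<tau> = t / 4"
    by (simp add: t_def power2_eq_square)
  ultimately have 1: "expi (t / 4) * (2 * F2 t ^ 2) = c * F1 \<tau> ^ 2"
    using c[of "1 / 2"] by metis
  have s: "(of_real (sqrt 2) :: complex)\<^sup>2 = 2"
    by (simp flip: of_real_power)
  have "weber_f2 t ^ 2 * weber_f \<tau> ^ 2 = 2 * expi (t / 6) * expi (- \<tau> / 12) * F2 t ^ 2 * F0 \<tau> ^ 2"
    unfolding weber_f2_eq[OF t] weber_f_eq[OF \<tau>] power_mult_distrib s expi_power F0_def F2_def by simp
  also have "expi (t / 6) = expi (- t / 12) * expi (t / 4)"
    by (simp flip: expi_add)
  also have "2 * (expi (- t / 12) * expi (t / 4)) * expi (- \<tau> / 12) * F2 t ^ 2 * F0 \<tau> ^ 2 =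
     expi (- t / 12) * expi (- \<tau> / 12) * F0 \<tau> ^ 2 * (expi (t / 4) * (2 * F2 t ^ 2))"
    by (simp only: ac_simps)
  also have "\<dots> = expi (- t / 12) * expi (- \<tau> / 12) * (c * F0 \<tau> ^ 2) * F1 \<tau> ^ 2"
    unfolding 1 by (simp only: ac_simps)
  also have "\<dots> = weber_f1 \<tau> ^ 2 * weber_f t ^ 2"
    unfolding 0[symmetric] unfolding weber_f1_eq[OF \<tau>] weber_f_eq[OF t] power_mult_distrib s expi_power F0_def F1_def
    by simp
  finally show ?thesis
    by (simp only: t_def)
qed

text \<open>For the squares of the Weber functions, the ratio law at \<tau> and at
  \<open>- 1 / \<tau>\<close> together with the product formula at both points forces
  \<open>a ^ 3 = a' ^ 3\<close>.\<close>

lemma weber_inversion_6: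
  assumes \<tau>: "Im \<tau> > 0"
  shows "weber_f (- 1 / \<tau>) ^ 6 = weber_f \<tau> ^ 6"
    "weber_f2 (- 1 / \<tau>) ^ 6 = weber_f1 \<tau> ^ 6"
proof -
  let ?t = "- 1 / \<tau>"
  have t: "Im ?t > 0" using \<tau> by (rule Im_inversion)
  have [simp]: "\<tau> \<noteq> 0" using \<tau> by auto
  define a b c a' b' c' where "a = weber_f \<tau> ^ 2" and "b = weber_f1 \<tau> ^ 2" and "c = weber_f2 \<tau> ^ 2"
    and "a' = weber_f ?t ^ 2" and "b' = weber_f1 ?t ^ 2" and "c' = weber_f2 ?t ^ 2"
  have s: "(of_real (sqrt 2) :: complex)\<^sup>2 = 2"
    by (simp flip: of_real_power)
  have p: "a * b * c = 2" "a' * b' * c' = 2"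
    using weber_product[OF \<tau>] weber_product[OF t] s
    unfolding a_def b_def c_def a'_def b'_def c'_def by (simp_all flip: power_mult_distrib)
  have nz: "a \<noteq> 0" "a' \<noteq> 0" "b \<noteq> 0"
    using weber_nonzero[OF \<tau>] weber_nonzero[OF t] by (auto simp: a_def a'_def b_def)
  have 1: "c' * a = b * a'"
    using weber_inversion_ratio[OF \<tau>] by (simp add: a_def b_def a'_def c'_def)
  have 2: "c * a' = b' * a"
    using weber_inversion_ratio[OF t] by (simp add: a_def c_def a'_def b'_def)
  have "2 * a ^ 3 = a ^ 2 * a * (a' * b' * c')"
    unfolding p by (simp add: power3_eq_cube power2_eq_square)
  also have "\<dots> = a' * a * (c' * a) * (b' * a)"
    by (simp add: power2_eq_square)
  also have "\<dots> = a' ^ 2 * a' * (a * b * c)"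
    unfolding 1 2[symmetric] by (simp add: power2_eq_square)
  also have "\<dots> = 2 * a' ^ 3"
    unfolding p by (simp add: power3_eq_cube power2_eq_square)
  finally have 3: "a ^ 3 = a' ^ 3" by simp
  then show "weber_f ?t ^ 6 = weber_f \<tau> ^ 6"
    by (simp add: a_def a'_def flip: power_mult)
  have "c' ^ 3 * a ^ 3 = b ^ 3 * a' ^ 3"
    using 1 by (metis power_mult_distrib)
  then have "c' ^ 3 = b ^ 3"
    using 3 nz by simp
  then show "weber_f2 ?t ^ 6 = weber_f1 \<tau> ^ 6"
    by (simp add: c'_def b_def flip: power_mult)
qed

section \<open>Removing the root of unity\<close>

lemma continuous_on_weber:
  "continuous_on {\<tau>. Im \<tau> > 0} weber_f" "continuous_on {\<tau>. Im \<tau> > 0} weber_f1"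
  "continuous_on {\<tau>. Im \<tau> > 0} weber_f2"
proof -
  have o: "open {\<tau>. Im \<tau> > 0}" by (rule open_halfspace_Im_gt)
  have "(\<lambda>\<tau>. expi (- \<tau> / 24) * qpoch (expi \<tau>) ((expi \<tau>)\<^sup>2)) holomorphic_on {\<tau>. Im \<tau> > 0}"
    "(\<lambda>\<tau>. expi (- \<tau> / 24) * qpoch (- expi \<tau>) ((expi \<tau>)\<^sup>2)) holomorphic_on {\<tau>. Im \<tau> > 0}"
    "(\<lambda>\<tau>. of_real (sqrt 2) * expi (\<tau> / 12) * qpoch ((expi \<tau>)\<^sup>2) ((expi \<tau>)\<^sup>2))
      holomorphic_on {\<tau>. Im \<tau> > 0}"
    using o norm_nome(2) by (intro holomorphic_intros; auto)+
  note hol = this[THEN holomorphic_on_imp_continuous_on]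
  show "continuous_on {\<tau>. Im \<tau> > 0} weber_f" "continuous_on {\<tau>. Im \<tau> > 0} weber_f1"
    "continuous_on {\<tau>. Im \<tau> > 0} weber_f2"
    by (rule continuous_on_cong[THEN iffD2, OF refl _ hol(1)], simp add: weber_f_eq)
       (rule continuous_on_cong[THEN iffD2, OF refl _ hol(2)], simp add: weber_f1_eq,
        rule continuous_on_cong[THEN iffD2, OF refl _ hol(3)], simp add: weber_f2_eq)
qed

text \<open>The nome at \<i> is the real number \<open>exp (- pi)\<close> between 0 and 1, so the
  product expansions are positive.\<close>

lemma weber_at_i:
  "\<exists>r>0. weber_f \<i> = of_real r" "\<exists>r>0. weber_f1 \<i> = of_real r" "\<exists>r>0. weber_f2 \<i> = of_real r"
proof -
  have e: "expi (of_real t * \<i>) = of_real (exp (- pi * t))" for t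
  proof -
    have "of_real pi * \<i> * (of_real t * \<i>) = (of_real (- pi * t) :: complex)"
      by (simp add: complex_eq_iff)
    then show ?thesis
      unfolding expi_def by (simp only: exp_of_real)
  qed
  define x where "x = exp (- pi)"
  have x: "0 < x" "x < 1" "0 < x\<^sup>2" "x\<^sup>2 < 1"
    by (auto simp: x_def power_less_one_iff)
  have ei: "expi \<i> = of_real x" "expi (- \<i> / 24) = of_real (exp (pi / 24))"
    "expi (\<i> / 12) = of_real (exp (- pi / 12))"
    using e[of 1] e[of "- 1 / 24"] e[of "1 / 12"] by (simp_all add: x_def)
  obtain r0 r1 r2 where r: "r0 > 0" "qpoch (of_real x) (of_real (x\<^sup>2)) = of_real r0"
    "r1 > 0" "qpoch (of_real (- x)) (of_real (x\<^sup>2)) = of_real r1"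
    "r2 > 0" "qpoch (of_real (x\<^sup>2)) (of_real (x\<^sup>2)) = of_real r2"
    using qpoch_of_real_pos[of x "x\<^sup>2"] qpoch_of_real_pos[of "- x" "x\<^sup>2"] qpoch_of_real_pos[of "x\<^sup>2" "x\<^sup>2"] x
    by force
  have i: "Im \<i> > 0" by simp
  have "weber_f \<i> = of_real (exp (pi / 24) * r0)" "weber_f1 \<i> = of_real (exp (pi / 24) * r1)"
    "weber_f2 \<i> = of_real (sqrt 2 * exp (- pi / 12) * r2)"
    unfolding weber_f_eq[OF i] weber_f1_eq[OF i] weber_f2_eq[OF i] ei using r by simp_all
  then show "\<exists>r>0. weber_f \<i> = of_real r" "\<exists>r>0. weber_f1 \<i> = of_real r" "\<exists>r>0. weber_f2 \<i> = of_real r"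
    using r by (metis exp_gt_zero mult_pos_pos real_sqrt_gt_zero zero_less_numeral)+
qed

text \<open>The image is connected and finite, hence a single point.\<close>

lemma root_of_unity_valued_constant:
  fixes \<rho> :: "'a::topological_space \<Rightarrow> complex"
  assumes "connected S" "continuous_on S \<rho>" "\<And>z. z \<in> S \<Longrightarrow> \<rho> z ^ n = 1" "n > 0" "x \<in> S" "y \<in> S"
  shows "\<rho> x = \<rho> y"
proof -
  have "finite (\<rho> ` S)"
    by (rule finite_subset[OF _ finite_roots_unity[of n]]) (use assms in auto)
  moreover have "connected (\<rho> ` S)"
    by (rule connected_continuous_image[OF assms(2,1)])
  ultimately obtain a where "\<rho> ` S = {a}"
    using assms(5) connected_finite_iff_sing[of "\<rho> ` S"] by auto
  with assms(5,6) show ?thesis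
    by (metis image_eqI singletonD)
qed

lemma weber_inversion:
  assumes \<tau>: "Im \<tau> > 0"
  shows "weber_f (- 1 / \<tau>) = weber_f \<tau>" "weber_f2 (- 1 / \<tau>) = weber_f1 \<tau>"
    "weber_f1 (- 1 / \<tau>) = weber_f2 \<tau>"
proof -
  let ?H = "{\<tau>. Im \<tau> > 0}"
  have H: "connected ?H" "\<tau> \<in> ?H" "\<i> \<in> ?H"
    using \<tau> by (auto intro: convex_connected convex_halfspace_Im_gt)
  have inv: "continuous_on ?H (\<lambda>z. - 1 / z)" "(\<lambda>z. - 1 / z) ` ?H \<subseteq> ?H"
    using Im_inversion by (auto intro!: continuous_intros)
  note cont = continuous_on_weber continuous_on_weber[THEN continuous_on_compose2, OF inv]
  have S: "weber_f (- 1 / \<tau>) = weber_f \<tau>" "weber_f2 (- 1 / \<tau>) = weber_f1 \<tau>" if \<tau>: "Im \<tau> > 0" for \<tau>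
  proof -
    from \<tau> have \<tau>H: "\<tau> \<in> ?H" by simp
    \<comment> \<open>The fixed point \<i> of the inversion determines the constant: there this
      quotient is 1.\<close>
    have "weber_f (- 1 / \<tau>) / weber_f \<tau> = weber_f (- 1 / \<i>) / weber_f \<i>"
    proof (rule root_of_unity_valued_constant[OF H(1) _ _ _ \<tau>H H(3)])
      show "continuous_on ?H (\<lambda>\<tau>. weber_f (- 1 / \<tau>) / weber_f \<tau>)"
        by (intro continuous_on_divide cont ballI) (simp add: weber_nonzero)
      show "(weber_f (- 1 / z) / weber_f z) ^ 6 = 1" if "z \<in> ?H" for z
        using that weber_inversion_6[of z] weber_nonzero[of z] by (simp add: power_divide)
    qed auto
    then show "weber_f (- 1 / \<tau>) = weber_f \<tau>"
      using weber_nonzero[OF \<tau>] weber_nonzero[of \<i>] by simp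
    have "weber_f2 (- 1 / \<tau>) / weber_f1 \<tau> = weber_f2 (- 1 / \<i>) / weber_f1 \<i>"
    proof (rule root_of_unity_valued_constant[OF H(1) _ _ _ \<tau>H H(3)])
      show "continuous_on ?H (\<lambda>\<tau>. weber_f2 (- 1 / \<tau>) / weber_f1 \<tau>)"
        by (intro continuous_on_divide cont ballI) (simp add: weber_nonzero)
      show "(weber_f2 (- 1 / z) / weber_f1 z) ^ 6 = 1" if "z \<in> ?H" for z
        using that weber_inversion_6[of z] weber_nonzero[of z] by (simp add: power_divide)
    qed auto
    \<comment> \<open>At the fixed point the sixth powers agree, and both values are positive
      reals.\<close>
    moreover have "weber_f2 \<i> = weber_f1 \<i>"
    proof -
      obtain r s where rs: "r > 0" "weber_f1 \<i> = of_real r" "s > 0" "weber_f2 \<i> = of_real s"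
        using weber_at_i by blast
      have "s ^ 6 = r ^ 6"
        using weber_inversion_6(2)[of \<i>] rs by (simp flip: of_real_power)
      with rs show ?thesis
        using power_eq_imp_eq_base[of s 6 r] by simp
    qed
    ultimately show "weber_f2 (- 1 / \<tau>) = weber_f1 \<tau>"
      using weber_nonzero[OF \<tau>] weber_nonzero[of \<i>] by simp
  qed
  show "weber_f (- 1 / \<tau>) = weber_f \<tau>" "weber_f2 (- 1 / \<tau>) = weber_f1 \<tau>"
    by (rule S[OF \<tau>])+
  show "weber_f1 (- 1 / \<tau>) = weber_f2 \<tau>"
    using S(2)[OF Im_inversion[OF \<tau>]] by simp
qed

section \<open>The action of the modular group\<close>

text \<open>The Euclidean algorithm on the bottom row. The rules are right multiplications by the
  translation T, its inverse and the inversion S, which correspond to substitutions in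
  \<tau>.\<close>

lemma SL2Z_induct:
  fixes a b c d :: int
  assumes det: "a * d - b * c = 1" and one: "P 1 0 0 1"
    and T: "\<And>a b c d. a * d - b * c = 1 \<Longrightarrow> P a b c d \<Longrightarrow> P a (b + a) c (d + c)"
    and T': "\<And>a b c d. a * d - b * c = 1 \<Longrightarrow> P a b c d \<Longrightarrow> P a (b - a) c (d - c)"
    and S: "\<And>a b c d. a * d - b * c = 1 \<Longrightarrow> P a b c d \<Longrightarrow> P b (- a) d (- c)"
  shows "P a b c d"
proof -
  have Tn: "P a (b + n * a) c (d + n * c)" if "a * d - b * c = 1" "P a b c d" for a b c d n
  proof (induction n rule: int_induct[where k = 0])
    case base
    show ?case using that by simp
  next
    case (step1 i)
    then show ?case
      using T[of a "d + i * c" "b + i * a" c] that(1) by (simp add: algebra_simps)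
  next
    case (step2 i)
    then show ?case
      using T'[of a "d + i * c" "b + i * a" c] that(1) by (simp add: algebra_simps)
  qed
  \<comment> \<open>S has order 4, so three applications invert it.\<close>
  have S': "P a b c d" if "a * d - b * c = 1" "P b (- a) d (- c)" for a b c d
  proof -
    have "P (- a) (- b) (- c) (- d)"
      using S[of b "- c" "- a" d] that by (simp add: mult.commute)
    then have "P (- b) a (- d) c"
      using S[of "- a" "- d" "- b" "- c"] that by simp
    then show ?thesis
      using S[of "- b" c a "- d"] that by (simp add: mult.commute)
  qed
  show ?thesis
    using det
  proof (induction "nat \<bar>c\<bar>" arbitrary: a b c d rule: less_induct)
    case less
    show ?case
    proof (cases "c = 0")
      case True
      with less.prems have "a = 1 \<and> d = 1 \<or> a = - 1 \<and> d = - 1"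
        by (simp add: zmult_eq_1_iff)
      moreover have "P (- 1) 0 0 (- 1)"
        using S[OF _ S[OF _ one]] by simp
      ultimately show ?thesis
        using Tn[of 1 1 0 0 b] Tn[of "- 1" "- 1" 0 0 "- b"] one True by auto
    next
      case False
      \<comment> \<open>Subtracting \<open>n\<close> times the first column leaves the remainder
        \<open>d - n * c\<close>; S moves it to the lower left entry, where it is smaller than
        \<open>c\<close> in absolute value.\<close>
      define n where "n = d div c"
      have "\<bar>d - n * c\<bar> < \<bar>c\<bar>"
        using False by (simp add: n_def minus_div_mult_eq_mod abs_mod_less)
      then have "P (b - n * a) (- a) (d - n * c) (- c)"
        using less.hyps[of "d - n * c" "b - n * a" "- c" "- a"] less.prems by (simp add: algebra_simps)
      then have "P a (b - n * a) c (d - n * c)"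
        using S'[of a "d - n * c" "b - n * a" c] less.prems by (simp add: algebra_simps)
      then show ?thesis
        using Tn[of a "d - n * c" "b - n * a" c n] less.prems by (simp add: algebra_simps)
    qed
  qed
qed

text \<open>The Weber functions are permuted like the nonzero row vectors \<open>(r, s)\<close> over the field with
  two elements: \<open>(1, 1)\<close>, \<open>(1, 0)\<close>, \<open>(0, 1)\<close> stand for the indices 0, 1, 2.\<close>

definition weber_index :: "int \<Rightarrow> int \<Rightarrow> nat" where
  "weber_index r s = (if odd r then if odd s then 0 else 1 else 2)"

lemma weber_u_simps:
  "weber_u 0 \<tau> = weber_f \<tau>" "weber_u (Suc 0) \<tau> = zeta 16 * weber_f1 \<tau>"
  "weber_u 2 \<tau> = inverse (zeta 16) * weber_f2 \<tau>"
  by (simp_all add: weber_u_def)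

lemma zeta_16_power_8: "zeta 16 ^ 8 = - 1"
  by (simp add: zeta_eq_expi expi_power)

lemma weber_u_nonzero: "Im \<tau> > 0 \<Longrightarrow> weber_u i \<tau> \<noteq> 0"
  by (simp add: weber_u_def weber_nonzero zeta_eq_expi)

text \<open>The factor \<open>zeta 16\<close> has eighth power -1; this sign makes all three
  functions pick up the same cube root of unity.\<close>

lemma weber_u_add_1:
  assumes "Im \<tau> > 0" "odd r \<or> odd s"
  shows "weber_u (weber_index r s) (\<tau> + 1) ^ 8 = expi (2 / 3) * weber_u (weber_index r (r + s)) \<tau> ^ 8"
proof -
  have "expi (- 1 / 24) ^ 8 = - expi (2 / 3)"
    using expi_add_1[of "- 1 / 3"] by (simp add: expi_power)
  moreover have "expi (1 / 12) ^ 8 = expi (2 / 3)"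
    by (simp add: expi_power)
  ultimately show ?thesis
    using assms by (auto simp: weber_index_def weber_u_simps weber_add_1 power_mult_distrib
        power_inverse zeta_16_power_8)
qed

lemma weber_u_inversion:
  assumes "Im \<tau> > 0" "odd r \<or> odd s"
  shows "weber_u (weber_index r s) (- 1 / \<tau>) ^ 8 = weber_u (weber_index s (- r)) \<tau> ^ 8"
  using assms weber_inversion[OF assms(1)]
  by (auto simp: weber_index_def weber_u_simps power_mult_distrib power_inverse zeta_16_power_8)

text \<open>The exponent of the character of \<open>\<eta>\<^sup>8\<close>, modulo 3.\<close>

definition eta8_exponent :: "int \<Rightarrow> int \<Rightarrow> int \<Rightarrow> int \<Rightarrow> int" where
  "eta8_exponent a b c d = b * d * (1 - c\<^sup>2) + c * (a + d)"

lemma expi_third_eq_1_iff: "expi (2 * of_int k / 3) = 1 \<longleftrightarrow> 3 dvd k"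
proof -
  have "expi (2 * of_int k / 3) = 1 \<longleftrightarrow> (\<exists>n::int. (of_int k :: complex) = of_int (3 * n))"
    unfolding expi_eq_1_iff by (simp add: field_simps)
  then show ?thesis
    unfolding of_int_eq_iff by (auto simp: dvd_def)
qed

lemma expi_third_cong:
  assumes "3 dvd k - l"
  shows "expi (2 * of_int k / 3) = expi (2 * of_int l / 3)"
proof -
  have "2 * of_int k / 3 = 2 * of_int (k - l) / 3 + (2 * of_int l / 3 :: complex)"
    by (simp add: field_simps)
  then show ?thesis
    using assms by (simp only: expi_add expi_third_eq_1_iff[THEN iffD2]) simp
qed

lemma three_dvd_cube_minus: "(3::int) dvd c - c ^ 3"
proof -
  have "3 dvd c \<or> 3 dvd 1 - c \<or> 3 dvd 1 + c"
    by presburger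
  then have "3 dvd c * ((1 - c) * (1 + c))"
    by auto
  then show ?thesis
    by (simp add: algebra_simps power3_eq_cube)
qed

lemma eta8_exponent_T:
  assumes "a * d - b * c = 1"
  shows "3 dvd eta8_exponent a (b + a) c (d + c) - (eta8_exponent a b c d + 1)"
proof -
  \<comment> \<open>The first summand is divisible by 3 by Fermat's little theorem; the second is 0
    by the determinant.\<close>
  have "eta8_exponent a (b + a) c (d + c) - (eta8_exponent a b c d + 1)
    = (c - c ^ 3) * (2 * b + a) + (1 - c\<^sup>2) * ((a * d - b * c) - 1)"
    by (simp add: eta8_exponent_def algebra_simps power2_eq_square power3_eq_cube)
  then show ?thesis
    using assms three_dvd_cube_minus[of c] by simp
qed

lemma eta8_exponent_S:
  assumes "a * d - b * c = 1"
  shows "3 dvd eta8_exponent b (- a) d (- c) - eta8_exponent a b c d"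
proof -
  have "eta8_exponent b (- a) d (- c) - eta8_exponent a b c d
    = - 3 * (c * d) - c * d * ((a * d - b * c) - 1)"
    by (simp add: eta8_exponent_def algebra_simps power2_eq_square)
  then show ?thesis
    using assms by simp
qed

text \<open>The induction hypothesis is used at the point substituted by a generator and followed by
  the law of that generator; the row vector \<open>(r, s)\<close> is multiplied by the matrix on the
  right.\<close>

lemma weber_u_transformation:
  assumes det: "a * d - b * c = 1" and "Im \<tau> > 0" "odd r \<or> odd s"
  shows "weber_u (weber_index r s) ((of_int a * \<tau> + of_int b) / (of_int c * \<tau> + of_int d)) ^ 8 =
    expi (2 * of_int (eta8_exponent a b c d) / 3) *
    weber_u (weber_index (r * a + s * c) (r * b + s * d)) \<tau> ^ 8"
proof -
  define P where "P a b c d \<longleftrightarrow> (\<forall>\<tau> r s. Im \<tau> > 0 \<longrightarrow> odd r \<or> odd s \<longrightarrow>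
    weber_u (weber_index r s) ((of_int a * \<tau> + of_int b) / (of_int c * \<tau> + of_int d)) ^ 8 =
    expi (2 * of_int (eta8_exponent a b c d) / 3) *
    weber_u (weber_index (r * a + s * c) (r * b + s * d)) \<tau> ^ 8)" for a b c d :: int
  have odd: "odd (r * a + s * c) \<or> odd (r * b + s * d)"
    if "a * d - b * c = 1" "odd r \<or> odd s" for a b c d r s :: int
  proof -
    \<comment> \<open>Cramer's rule recovers \<open>(r, s)\<close> from its image, so a row vector
      that is nonzero modulo 2 has a nonzero image.\<close>
    have "d * (r * a + s * c) - c * (r * b + s * d) = r * (a * d - b * c)"
      "a * (r * b + s * d) - b * (r * a + s * c) = s * (a * d - b * c)"
      by (simp_all add: algebra_simps)
    with that show ?thesis
      by (metis dvd_diff dvd_mult mult.right_neutral)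
  qed
  have "P a b c d"
  proof (rule SL2Z_induct[OF det, of P])
    show "P 1 0 0 1" by (simp add: P_def eta8_exponent_def)
  next
    fix a b c d :: int
    assume det: "a * d - b * c = 1" and IH: "P a b c d"
    show "P a (b + a) c (d + c)"
      unfolding P_def
    proof (intro allI impI)
      fix \<tau> and r s :: int
      assume *: "Im \<tau> > 0" "odd r \<or> odd s"
      let ?k = "eta8_exponent a b c d"
      have "(of_int a * \<tau> + of_int (b + a)) / (of_int c * \<tau> + of_int (d + c)) =
          (of_int a * (\<tau> + 1) + of_int b) / (of_int c * (\<tau> + 1) + of_int d)"
        by (simp add: algebra_simps)
      then have "weber_u (weber_index r s) ((of_int a * \<tau> + of_int (b + a)) / (of_int c * \<tau> + of_int (d + c))) ^ 8
        = expi (2 * of_int ?k / 3) * weber_u (weber_index (r * a + s * c) (r * b + s * d)) (\<tau> + 1) ^ 8"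
        using IH * by (simp add: P_def)
      also have "\<dots> = expi (2 * of_int ?k / 3) * expi (2 / 3) *
          weber_u (weber_index (r * a + s * c) (r * (b + a) + s * (d + c))) \<tau> ^ 8"
        using weber_u_add_1[OF *(1) odd[OF det *(2)]] by (simp add: algebra_simps)
      also have "expi (2 * of_int ?k / 3) * expi (2 / 3) = expi (2 * of_int (?k + 1) / 3)"
        by (simp flip: expi_add add: add_divide_distrib)
      also have "\<dots> = expi (2 * of_int (eta8_exponent a (b + a) c (d + c)) / 3)"
        using expi_third_cong[OF eta8_exponent_T[OF det]] by simp
      finally show "weber_u (weber_index r s) ((of_int a * \<tau> + of_int (b + a)) / (of_int c * \<tau> + of_int (d + c))) ^ 8
        = expi (2 * of_int (eta8_exponent a (b + a) c (d + c)) / 3) *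
          weber_u (weber_index (r * a + s * c) (r * (b + a) + s * (d + c))) \<tau> ^ 8" .
    qed
  next
    fix a b c d :: int
    assume det: "a * d - b * c = 1" and IH: "P a b c d"
    have det': "a * (d - c) - (b - a) * c = 1" using det by (simp add: algebra_simps)
    show "P a (b - a) c (d - c)"
      unfolding P_def
    proof (intro allI impI)
      fix \<tau> and r s :: int
      assume *: "Im \<tau> > 0" "odd r \<or> odd s"
      \<comment> \<open>For the inverse translation the law of T is read backwards, from the point
        \<open>\<tau> - 1\<close>.\<close>
      have **: "Im (\<tau> - 1) > 0" using * by simp
      let ?k = "eta8_exponent a b c d" and ?k' = "eta8_exponent a (b - a) c (d - c)"
      let ?v = "weber_u (weber_index (r * a + s * c) (r * b + s * d)) (\<tau> - 1) ^ 8"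
      have "weber_u (weber_index (r * a + s * c) (r * (b - a) + s * (d - c))) \<tau> ^ 8 = expi (2 / 3) * ?v"
        using weber_u_add_1[OF ** odd[OF det' *(2)]] by (simp add: algebra_simps)
      moreover have "expi (2 * of_int ?k / 3) = expi (2 * of_int ?k' / 3) * expi (2 / 3)"
      proof -
        have "expi (2 * of_int ?k / 3) = expi (2 * of_int (?k' + 1) / 3)"
          by (rule expi_third_cong) (use eta8_exponent_T[OF det'] in simp)
        then show ?thesis
          by (simp flip: expi_add add: add_divide_distrib)
      qed
      moreover have "(of_int a * \<tau> + of_int (b - a)) / (of_int c * \<tau> + of_int (d - c)) =
          (of_int a * (\<tau> - 1) + of_int b) / (of_int c * (\<tau> - 1) + of_int d)"
        by (simp add: algebra_simps)
      then have "weber_u (weber_index r s) ((of_int a * \<tau> + of_int (b - a)) / (of_int c * \<tau> + of_int (d - c))) ^ 8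
        = expi (2 * of_int ?k / 3) * ?v"
        using IH ** *(2) by (simp add: P_def)
      ultimately show "weber_u (weber_index r s) ((of_int a * \<tau> + of_int (b - a)) / (of_int c * \<tau> + of_int (d - c))) ^ 8
        = expi (2 * of_int ?k' / 3) *
          weber_u (weber_index (r * a + s * c) (r * (b - a) + s * (d - c))) \<tau> ^ 8"
        by (simp only: mult.assoc)
    qed
  next
    fix a b c d :: int
    assume det: "a * d - b * c = 1" and IH: "P a b c d"
    show "P b (- a) d (- c)"
      unfolding P_def
    proof (intro allI impI)
      fix \<tau> and r s :: int
      assume *: "Im \<tau> > 0" "odd r \<or> odd s"
      then have [simp]: "\<tau> \<noteq> 0" by auto
      have "(of_int b * \<tau> + of_int (- a)) / (of_int d * \<tau> + of_int (- c)) =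
          (\<tau> * (of_int a * (- 1 / \<tau>) + of_int b)) / (\<tau> * (of_int c * (- 1 / \<tau>) + of_int d))"
        by (simp add: algebra_simps)
      also have "\<dots> = (of_int a * (- 1 / \<tau>) + of_int b) / (of_int c * (- 1 / \<tau>) + of_int d)"
        by (rule mult_divide_mult_cancel_left) simp
      finally have "weber_u (weber_index r s) ((of_int b * \<tau> + of_int (- a)) / (of_int d * \<tau> + of_int (- c))) ^ 8
        = expi (2 * of_int (eta8_exponent a b c d) / 3) *
          weber_u (weber_index (r * a + s * c) (r * b + s * d)) (- 1 / \<tau>) ^ 8"
        using IH *(2) Im_inversion[OF *(1)] unfolding P_def by presburger
      also have "\<dots> = expi (2 * of_int (eta8_exponent b (- a) d (- c)) / 3) *
          weber_u (weber_index (r * b + s * d) (r * - a + s * - c)) \<tau> ^ 8"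
        using weber_u_inversion[OF *(1) odd[OF det *(2)]] expi_third_cong[OF eta8_exponent_S[OF det]]
        by (simp add: algebra_simps)
      finally show "weber_u (weber_index r s) ((of_int b * \<tau> + of_int (- a)) / (of_int d * \<tau> + of_int (- c))) ^ 8
        = expi (2 * of_int (eta8_exponent b (- a) d (- c)) / 3) *
          weber_u (weber_index (r * b + s * d) (r * - a + s * - c)) \<tau> ^ 8" .
    qed
  qed
  with assms(2,3) show ?thesis by (simp add: P_def)
qed

text \<open>Signs of real values separate the functions: at \<i> only \<open>weber_u 0\<close> has a
  positive 24th power, and at \<open>\<i> + 1\<close> those of \<open>weber_u 1\<close> and
  \<open>weber_u 2\<close> have opposite signs.\<close>

lemma weber_u_24_distinct:
  assumes "\<forall>\<tau>. Im \<tau> > 0 \<longrightarrow> weber_u i \<tau> ^ 24 = weber_u j \<tau> ^ 24" "i \<in> {0, 1, 2}" "j \<in> {0, 1, 2}"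
  shows "i = j"
proof -
  have z: "zeta 16 ^ 24 = - 1" "expi (- (1 / 24)) ^ 24 = - 1" "expi (1 / 12) ^ 24 = 1"
    using expi_add_1[of "- 1"] expi_add_2[of 0] expi_add_2[of 1]
    by (simp_all add: zeta_eq_expi expi_power minus_equation_iff[of _ 1])
  obtain r0 r1 r2 where r: "r0 > 0" "weber_f \<i> = of_real r0" "r1 > 0" "weber_f1 \<i> = of_real r1"
    "r2 > 0" "weber_f2 \<i> = of_real r2"
    using weber_at_i by blast
  have pos: "r0 ^ 24 > 0" "r1 ^ 24 > 0" "r2 ^ 24 > 0" using r by auto
  have at_i: "weber_u 0 \<i> ^ 24 = of_real (r0 ^ 24)" "weber_u 1 \<i> ^ 24 = of_real (- (r1 ^ 24))"
    "weber_u 2 \<i> ^ 24 = of_real (- (r2 ^ 24))"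
    using r by (simp_all add: weber_u_simps power_mult_distrib z power_inverse)
  have at_Si: "weber_u 1 (\<i> + 1) ^ 24 = of_real (r0 ^ 24)" "weber_u 2 (\<i> + 1) ^ 24 = of_real (- (r2 ^ 24))"
    using r by (simp_all add: weber_u_simps power_mult_distrib z power_inverse weber_add_1)
  have "weber_u 0 \<i> ^ 24 \<noteq> weber_u 1 \<i> ^ 24" "weber_u 0 \<i> ^ 24 \<noteq> weber_u 2 \<i> ^ 24"
    "weber_u 1 (\<i> + 1) ^ 24 \<noteq> weber_u 2 (\<i> + 1) ^ 24"
    unfolding at_i at_Si of_real_eq_iff using pos by linarith+
  moreover have "weber_u i \<i> ^ 24 = weber_u j \<i> ^ 24" "weber_u i (\<i> + 1) ^ 24 = weber_u j (\<i> + 1) ^ 24"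
    using assms(1) by simp_all
  ultimately show ?thesis
    using assms(2,3) by (elim insertE emptyE) metis+
qed

section \<open>Normalizers of nonsplit Cartan subgroups modulo 3\<close>

lemma F3_cases: "x = 0 \<or> x = 1 \<or> x = 2" for x :: 3
  using exhaust_3[of x] by auto

lemma of_int_F3_eq_0_iff: "(of_int x :: 3) = 0 \<longleftrightarrow> 3 dvd x"
  by (simp add: of_int_eq_0_iff_char_dvd)

text \<open>With \<open>J = (p, q; r, - p)\<close>, these are the six matrices with square -1, the
  elements of order 4 in the quaternion group. Listing them keeps later case distinctions
  small.\<close>

lemma F3_trace_0_det_1:
  assumes "- p * p - q * r = (1::3)"
  shows "p = 0 \<and> q = 1 \<and> r = 2 \<or> p = 0 \<and> q = 2 \<and> r = 1 \<or> p = 1 \<and> q = 1 \<and> r = 1 \<or>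
    p = 1 \<and> q = 2 \<and> r = 2 \<or> p = 2 \<and> q = 1 \<and> r = 1 \<or> p = 2 \<and> q = 2 \<and> r = 2"
  using F3_cases[of p] F3_cases[of q] F3_cases[of r] assms
  by (elim disjE) (simp_all add: arith_3)

lemma F3_arith:
  "(0::3) + 0 = 0" "(0::3) + 1 = 1" "(0::3) + 2 = 2" "(1::3) + 0 = 1" "(1::3) + 1 = 2" "(1::3) + 2 = 0"
  "(2::3) + 0 = 2" "(2::3) + 1 = 0" "(2::3) + 2 = 1" "(0::3) - 0 = 0" "(0::3) - 1 = 2" "(0::3) - 2 = 1"
  "(1::3) - 0 = 1" "(1::3) - 1 = 0" "(1::3) - 2 = 2" "(2::3) - 0 = 2" "(2::3) - 1 = 1" "(2::3) - 2 = 0"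
  "(0::3) * 0 = 0" "(0::3) * 1 = 0" "(0::3) * 2 = 0" "(1::3) * 0 = 0" "(1::3) * 1 = 1" "(1::3) * 2 = 2"
  "(2::3) * 0 = 0" "(2::3) * 1 = 2" "(2::3) * 2 = 1" "- (0::3) = 0" "- (1::3) = 2" "- (2::3) = 1"
  "(0::3) \<noteq> 1" "(0::3) \<noteq> 2" "(1::3) \<noteq> 0" "(1::3) \<noteq> 2" "(2::3) \<noteq> 0" "(2::3) \<noteq> 1"
  by simp_all

text \<open>The equations are three entries of \<open>A ** J = J ** A\<close>. The only matrices of
  determinant 1 commuting with \<open>J\<close> are 1, -1, \<open>J\<close> and
  \<open>- J\<close>.\<close>

lemma F3_commute:
  fixes p q r a b c d :: 3
  assumes J: "- p * p - q * r = 1" and A: "a * d - b * c = 1"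
    and eqs: "b * r = q * c" "a * q - b * p = p * b + q * d" "c * p + d * r = r * a - p * c"
  shows "a + d = 0 \<or> b = 0 \<and> c = 0 \<and> a = d"
  using F3_trace_0_det_1[OF J] F3_cases[of a] F3_cases[of b] F3_cases[of c] F3_cases[of d] A eqs
  by (elim disjE conjE; simp only: F3_arith simp_thms)

text \<open>Two elements of order 4 in the quaternion group commute or anticommute.\<close>

lemma F3_trace_0_commute:
  fixes p q r a b c :: 3
  assumes J: "- p * p - q * r = 1" and A: "- a * a - b * c = 1"
  shows "a * p + b * r = p * a + q * c \<and> a * q - b * p = p * b - q * a \<and>
      c * p - a * r = r * a - p * c \<and> c * q + a * p = r * b + p * a \<or>
    a * p + b * r = - (p * a + q * c) \<and> a * q - b * p = - (p * b - q * a) \<and>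
      c * p - a * r = - (r * a - p * c) \<and> c * q + a * p = - (r * b + p * a)"
  using F3_trace_0_det_1[OF J] F3_trace_0_det_1[OF A]
  by (elim disjE conjE; simp only: F3_arith simp_thms)

text \<open>Identifies the kernel of the cubic character with the quaternion group, whose elements
  are those of trace 0 and the scalars 1 and -1.\<close>

lemma eta8_exponent_F3:
  fixes a b c d :: 3
  assumes "a * d - b * c = 1"
  shows "b * d * (1 - c * c) + c * (a + d) = 0 \<longleftrightarrow> a + d = 0 \<or> b = 0 \<and> c = 0 \<and> a = d"
  using F3_cases[of a] F3_cases[of b] F3_cases[of c] F3_cases[of d] assms
  by (elim disjE; simp only: F3_arith simp_thms)

section \<open>Generators and normalizers of nonsplit Cartan subgroups\<close>

lemma mat_3_mult:
  fixes X Y :: "3 ^ 2 ^ 2"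
  shows "mat x ** X = X ** mat x" "mat x + mat y = (mat (x + y) :: 3 ^ 2 ^ 2)"
    "mat x ** (mat y :: 3 ^ 2 ^ 2) = mat (x * y)" "- mat x = (mat (- x) :: 3 ^ 2 ^ 2)"
    "mat 0 = (0 :: 3 ^ 2 ^ 2)"
  by (simp_all add: vec_eq_iff forall_2 matrix_matrix_mult_def sum_2 mat_def algebra_simps)

lemma F3_square_nonzero: "x \<noteq> 0 \<Longrightarrow> x * x = (1::3)"
  using F3_cases[of x] by (elim disjE; simp add: F3_arith)

text \<open>A nonzero \<open>y\<close> is its own inverse, so multiplying by it would exhibit
  \<open>J\<close> as a scalar.\<close>

lemma mat_combination_eq_0_D:
  fixes J :: "3 ^ 2 ^ 2"
  assumes J: "J \<notin> range mat" and eq: "mat x + mat y ** J = 0"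
  shows "x = 0 \<and> y = 0"
proof -
  have "y = 0"
  proof (rule ccontr)
    assume y: "y \<noteq> 0"
    have "mat y ** (mat x + mat y ** J) = mat (y * x) + mat (y * y) ** J"
      by (simp add: matrix_add_ldistrib matrix_mul_assoc mat_3_mult(3))
    then have "mat (y * x) + J = 0"
      using eq F3_square_nonzero[OF y] by simp
    then have "J = mat (- (y * x))"
      by (simp add: eq_neg_iff_add_eq_0 add.commute flip: mat_3_mult(4))
    with J show False by blast
  qed
  moreover from this eq have "mat x = (0 :: 3 ^ 2 ^ 2)"
    by (simp add: mat_3_mult(5))
  then have "x = 0"
    by (auto simp: vec_eq_iff forall_2 mat_def)
  ultimately show ?thesis by simp
qed

text \<open>A subfield with nine elements is spanned over the scalars by 1 and any nonscalar
  element, which can be shifted to trace 0. Then \<open>J ** J = mat (- det J)\<close>, and the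
  absence of zero divisors leaves only determinant 1.\<close>

lemma nonsplit_Cartan_generator:
  assumes "nonsplit_Cartan C"
  obtains J where "J $ 2 $ 2 = - (J $ 1 $ 1)" "det J = 1"
    "C = {mat x + mat y ** J | x y. x \<noteq> 0 \<or> y \<noteq> 0}"
proof -
  interpret ring M2F3 by (rule ring_M2F3)
  obtain K where K: "subfield K M2F3" "card K = 9" and C: "C = K - {0}"
    using assms by (auto simp: nonsplit_Cartan_def M2F3_def)
  note sub = subfieldE[OF K(1)] subringE[OF subfieldE(1)[OF K(1)]]
  have one: "mat 1 \<in> K" and add: "\<And>X Y. X \<in> K \<Longrightarrow> Y \<in> K \<Longrightarrow> X + Y \<in> K"
    and mult: "\<And>X Y. X \<in> K \<Longrightarrow> Y \<in> K \<Longrightarrow> X ** Y \<in> K"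
    and integral: "\<And>X Y. X \<in> K \<Longrightarrow> Y \<in> K \<Longrightarrow> X ** Y = 0 \<Longrightarrow> X = 0 \<or> Y = 0"
    and zero: "0 \<in> K"
    using sub by (simp_all add: M2F3_def)
  have mat: "mat x \<in> K" for x
    using F3_cases[of x] one zero add[OF one one] by (auto simp: mat_3_mult arith_3)
  have "card (range (mat :: 3 \<Rightarrow> 3 ^ 2 ^ 2)) \<le> 3"
    using card_image_le[of UNIV "mat :: 3 \<Rightarrow> 3 ^ 2 ^ 2"] by simp
  then have "\<not> K \<subseteq> range mat"
    using K(2) card_mono[of "range (mat :: 3 \<Rightarrow> 3 ^ 2 ^ 2)" K] by auto
  then obtain J0 where J0: "J0 \<in> K" "J0 \<notin> range mat"
    by blast
  \<comment> \<open>Adding the trace as a scalar adds twice the trace, and three times it is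
    0.\<close>
  define J where "J = J0 + mat (J0 $ 1 $ 1 + J0 $ 2 $ 2)"
  have JK: "J \<in> K"
    unfolding J_def by (intro add J0 mat)
  have J: "J \<notin> range mat"
  proof
    assume "J \<in> range mat"
    then obtain x where "J = mat x" by blast
    then have "J0 = mat (x - (J0 $ 1 $ 1 + J0 $ 2 $ 2))"
      by (simp add: J_def vec_eq_iff forall_2 mat_def algebra_simps)
    with J0 show False by blast
  qed
  have "J $ 1 $ 1 + J $ 2 $ 2 = 3 * (J0 $ 1 $ 1 + J0 $ 2 $ 2)"
    by (simp add: J_def mat_def algebra_simps)
  then have trace: "J $ 2 $ 2 = - (J $ 1 $ 1)"
    by (simp add: arith_3 eq_neg_iff_add_eq_0 add.commute)
  define f where "f = (\<lambda>(x, y). mat x + mat y ** J)"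
  have fK: "range f \<subseteq> K"
    by (auto simp: f_def intro!: add mult mat JK)
  have "inj f"
  proof (rule injI, clarify)
    fix x y x' y' assume "f (x, y) = f (x', y')"
    then have "mat (x - x') + mat (y - y') ** J = 0"
      by (simp add: f_def vec_eq_iff forall_2 mat_def matrix_matrix_mult_def sum_2 algebra_simps)
    from mat_combination_eq_0_D[OF J this] show "x = x' \<and> y = y'" by simp
  qed
  then have "card (range f) = CARD(3 \<times> 3)"
    by (rule card_image)
  then have "card (range f) = card K"
    using K(2) by (simp add: card_cartesian_product flip: UNIV_Times_UNIV)
  then have rf: "range f = K"
    using fK K(2) by (intro card_subset_eq) (auto intro: card_ge_0_finite)
  have Jsq: "J ** J = mat (- det J)"
    using trace by (simp add: vec_eq_iff forall_2 mat_def matrix_matrix_mult_def sum_2 det_2 algebra_simps)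
  have "det J = 1"
  proof -
    have "det J \<noteq> 0"
    proof
      assume "det J = 0"
      then have "J = 0"
        using integral[OF JK JK] Jsq by (simp add: mat_3_mult(5))
      with J show False by (metis mat_3_mult(5) rangeI)
    qed
    moreover have "det J \<noteq> 2"
    proof
      assume "det J = 2"
      \<comment> \<open>Here \<open>J ** J = mat 1\<close>, and the polynomial
        \<open>X ^ 2 - 1\<close> factors as \<open>(X + 2) * (X + 1)\<close> modulo 3.\<close>
      then have "(J + mat 2) ** (J + mat 1) = 0"
        using Jsq trace
        by (simp add: vec_eq_iff forall_2 mat_def matrix_matrix_mult_def sum_2 algebra_simps arith_3)
      then have "J + mat 2 = 0 \<or> J + mat 1 = 0"
        using integral[of "J + mat 2" "J + mat 1"] add JK mat by blast
      then have "J = mat (- 2) \<or> J = mat (- 1)"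
        by (simp add: eq_neg_iff_add_eq_0 flip: mat_3_mult(4))
      with J show False by blast
    qed
    ultimately show ?thesis using F3_cases[of "det J"] by blast
  qed
  moreover have "C = {mat x + mat y ** J | x y. x \<noteq> 0 \<or> y \<noteq> 0}"
  proof (intro equalityI subsetI)
    fix X assume "X \<in> C"
    then obtain x y where X: "X = mat x + mat y ** J" "X \<noteq> 0"
      unfolding C rf[symmetric] by (auto simp: f_def)
    then have "x \<noteq> 0 \<or> y \<noteq> 0"
      by (auto simp: mat_3_mult(5))
    with X(1) show "X \<in> {mat x + mat y ** J | x y. x \<noteq> 0 \<or> y \<noteq> 0}" by blast
  next
    fix X assume "X \<in> {mat x + mat y ** J | x y. x \<noteq> 0 \<or> y \<noteq> 0}"
    then obtain x y where X: "X = mat x + mat y ** J" "x \<noteq> 0 \<or> y \<noteq> 0" by blast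
    then have "X \<noteq> 0" using mat_combination_eq_0_D[OF J, of x y] by auto
    with X(1) show "X \<in> C" unfolding C rf[symmetric] by (auto simp: f_def image_iff)
  qed
  ultimately show thesis using that trace by blast
qed

text \<open>The conjugation action behind \<open>normalizer\<close> lives on subsets of the carrier,
  so \<open>C\<close> must first be seen to consist of invertible matrices, as the nonzero elements
  of a subfield do.\<close>

lemma normalizer_GL2F3_iff:
  fixes A B :: "3 ^ 2 ^ 2"
  assumes "nonsplit_Cartan C" and AB: "A ** B = mat 1" "B ** A = mat 1"
  shows "A \<in> normalizer GL2F3 C \<longleftrightarrow> (\<lambda>X. A ** X ** B) ` C = C"
proof -
  interpret ring M2F3 by (rule ring_M2F3)
  obtain K where K: "subfield K M2F3" and C: "C = K - {\<zero>\<^bsub>M2F3\<^esub>}"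
    using assms(1) by (auto simp: nonsplit_Cartan_def)
  have CU: "C \<subseteq> carrier GL2F3"
    using subfield_m_inv[OF K] subfieldE(3)[OF K]
    by (auto simp: C GL2F3_def units_of_def Units_def M2F3_def)
  have A: "A \<in> carrier GL2F3" "B \<in> carrier GL2F3"
    using AB by (auto simp: GL2F3_def units_of_def Units_def M2F3_def)
  interpret GL: group GL2F3
    unfolding GL2F3_def by (rule units_group)
  have mult: "X \<otimes>\<^bsub>GL2F3\<^esub> Y = X ** Y" for X Y
    by (simp add: GL2F3_def units_of_def M2F3_def)
  have "inv\<^bsub>GL2F3\<^esub> A = B"
    using A AB by (intro GL.inv_equality) (simp_all add: mult, simp add: GL2F3_def units_of_def M2F3_def)
  then have "A <#\<^bsub>GL2F3\<^esub> C #>\<^bsub>GL2F3\<^esub> inv\<^bsub>GL2F3\<^esub> A = (\<lambda>X. A ** X ** B) ` C"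
    by (auto simp: l_coset_def r_coset_def mult)
  then show ?thesis
    using A CU by (simp add: normalizer_def stabilizer_def)
qed

text \<open>An element of determinant 1 normalizes the Cartan subgroup iff it commutes with the generator \<open>J\<close>
  (a square root of -1) up to sign, that is, iff it lies in the quaternion group of order 8.\<close>

lemma normalizer_nonsplit_Cartan_iff:
  fixes A :: "3 ^ 2 ^ 2"
  assumes C: "nonsplit_Cartan C" and det: "det A = 1"
  shows "A \<in> normalizer GL2F3 C \<longleftrightarrow>
    A $ 1 $ 1 + A $ 2 $ 2 = 0 \<or> A $ 1 $ 2 = 0 \<and> A $ 2 $ 1 = 0 \<and> A $ 1 $ 1 = A $ 2 $ 2"
proof -
  note entries = vec_eq_iff forall_2 mat_def matrix_matrix_mult_def sum_2
  obtain J where trace: "J $ 2 $ 2 = - (J $ 1 $ 1)" and detJ: "det J = 1"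
    and C_eq: "C = {mat x + mat y ** J | x y. x \<noteq> 0 \<or> y \<noteq> 0}"
    using nonsplit_Cartan_generator[OF C] .
  define a b c d where "a = A $ 1 $ 1" and "b = A $ 1 $ 2" and "c = A $ 2 $ 1" and "d = A $ 2 $ 2"
  note abcd = a_def[symmetric] b_def[symmetric] c_def[symmetric] d_def[symmetric]
  define p q r where "p = J $ 1 $ 1" and "q = J $ 1 $ 2" and "r = J $ 2 $ 1"
  note pqr = p_def[symmetric] q_def[symmetric] r_def[symmetric] trace[folded p_def]
  have J: "- p * p - q * r = 1"
    using detJ unfolding det_2 pqr by simp
  have A: "a * d - b * c = 1"
    using det unfolding det_2 abcd .
  define B :: "3 ^ 2 ^ 2" where "B = vector [vector [d, - b], vector [- c, a]]"
  have AB: "A ** B = mat 1" "B ** A = mat 1"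
    using A by (simp_all add: entries B_def abcd algebra_simps)
  have conj: "A ** (mat x + mat y ** J) ** B = mat x + mat y ** (A ** J ** B)" for x y
  proof -
    have "A ** (mat x + mat y ** J) ** B = (A ** mat x) ** B + (A ** mat y) ** J ** B"
      by (simp add: entries algebra_simps)
    also have "\<dots> = mat x ** (A ** B) + mat y ** (A ** J ** B)"
      by (simp only: mat_3_mult(1)[where X = A, symmetric] matrix_mul_assoc)
    finally show ?thesis by (simp add: AB)
  qed
  show ?thesis
    unfolding normalizer_GL2F3_iff[OF C AB] abcd
  proof
    assume eq: "(\<lambda>X. A ** X ** B) ` C = C"
    have "mat 0 + mat 1 ** J \<in> C"
      unfolding C_eq by (rule CollectI, rule exI[of _ 0], rule exI[of _ 1]) simp
    then have "A ** (mat 0 + mat 1 ** J) ** B \<in> C"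
      using eq by blast
    then have "A ** J ** B \<in> C"
      by (simp add: mat_3_mult(5))
    then obtain x y where xy: "A ** J ** B = mat x + mat y ** J" "x \<noteq> 0 \<or> y \<noteq> 0"
      unfolding C_eq by blast
    \<comment> \<open>Conjugation preserves the trace, so the image of \<open>J\<close> has trace 0
      and its scalar part \<open>x\<close> vanishes.\<close>
    have "(A ** J ** B) $ 1 $ 1 + (A ** J ** B) $ 2 $ 2 = (a * d - b * c) * (p - p)"
      by (simp add: matrix_matrix_mult_def sum_2 B_def abcd pqr algebra_simps)
    then have "(mat x + mat y ** J) $ 1 $ 1 + (mat x + mat y ** J) $ 2 $ 2 = 0"
      unfolding xy by simp
    then have "x + x = 0"
      by (simp add: mat_def matrix_matrix_mult_def sum_2 pqr algebra_simps)
    then have x: "x = 0"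
      using F3_cases[of x] by (elim disjE; simp add: F3_arith)
    have "A ** J = (A ** J ** B) ** A"
      by (simp add: AB flip: matrix_mul_assoc)
    also have "\<dots> = mat y ** (J ** A)"
      unfolding xy x by (simp add: mat_3_mult(5) matrix_mul_assoc)
    finally have "A ** J = mat y ** (J ** A)" .
    then have eqs: "a * p + b * r = y * (p * a + q * c)" "a * q - b * p = y * (p * b + q * d)"
      "c * p + d * r = y * (r * a - p * c)" "c * q - d * p = y * (r * b - p * d)"
      by (simp_all add: entries abcd pqr algebra_simps)
    have "y = 1 \<or> y = 2"
      using F3_cases[of y] xy(2) x by auto
    then show "a + d = 0 \<or> b = 0 \<and> c = 0 \<and> a = d"
    proof
      assume "y = 1"
      then show ?thesis
        using F3_commute[OF J A] eqs by (simp add: algebra_simps)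
    next
      assume "y = 2"
      then have y: "y = - 1" by (simp add: arith_3)
      have two: "z = 0" if "z + z = 0" for z :: 3
        using F3_cases[of z] that by (elim disjE; simp add: F3_arith)
      \<comment> \<open>When \<open>A\<close> anticommutes with \<open>J\<close>, its trace
        annihilates every entry of \<open>J\<close>; since \<open>det J = 1\<close>, the trace is
        0.\<close>
      have "p * (a + d) + p * (a + d) = (a * p + b * r + (p * a + q * c)) - (c * q - d * p + (r * b - p * d))"
        "q * (a + d) = a * q - b * p + (p * b + q * d)" "r * (a + d) = c * p + d * r + (r * a - p * c)"
        by (simp_all add: algebra_simps)
      then have "p * (a + d) = 0" "q * (a + d) = 0" "r * (a + d) = 0"
        using eqs two[of "p * (a + d)"] unfolding y by simp_all
      moreover have "(- p * p - q * r) * (a + d) = - p * (p * (a + d)) - q * (r * (a + d))"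
        by (simp add: algebra_simps)
      then have "a + d = - p * (p * (a + d)) - q * (r * (a + d))"
        unfolding J by simp
      ultimately show ?thesis by simp
    qed
  next
    assume *: "a + d = 0 \<or> b = 0 \<and> c = 0 \<and> a = d"
    have "\<exists>y. A ** J = mat y ** (J ** A) \<and> y * y = 1"
    proof (cases "a + d = 0")
      case True
      then have d: "d = - a" by (simp add: eq_neg_iff_add_eq_0 add.commute)
      have "- a * a - b * c = 1" using A d by simp
      from F3_trace_0_commute[OF J this] show ?thesis
      proof (elim disjE)
        assume "a * p + b * r = p * a + q * c \<and> a * q - b * p = p * b - q * a \<and>
          c * p - a * r = r * a - p * c \<and> c * q + a * p = r * b + p * a"
        then have "A ** J = mat 1 ** (J ** A)"
          by (simp add: entries abcd pqr d)
        then show ?thesis by (metis mult_1)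
      next
        assume "a * p + b * r = - (p * a + q * c) \<and> a * q - b * p = - (p * b - q * a) \<and>
          c * p - a * r = - (r * a - p * c) \<and> c * q + a * p = - (r * b + p * a)"
        then have "A ** J = mat (- 1) ** (J ** A)"
          by (simp add: entries abcd pqr d)
        then show ?thesis by (intro exI[of _ "- 1"]) simp
      qed
    next
      case False
      with * have "A ** J = mat 1 ** (J ** A)"
        by (simp add: entries abcd pqr algebra_simps)
      then show ?thesis by (metis mult_1)
    qed
    then obtain y where y: "A ** J = mat y ** (J ** A)" "y * y = 1" by blast
    have "A ** J ** B = mat y ** J"
      unfolding y(1) by (simp add: AB flip: matrix_mul_assoc)
    then have act: "A ** (mat u + mat v ** J) ** B = mat u + mat (v * y) ** J" for u v
      by (simp add: conj matrix_mul_assoc mat_3_mult(3))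
    have ne: "v * y \<noteq> 0" if "v \<noteq> 0" for v
      using that y(2) by (metis mult.assoc mult.right_neutral mult_zero_left)
    show "(\<lambda>X. A ** X ** B) ` C = C"
    proof (intro equalityI subsetI)
      fix X assume "X \<in> (\<lambda>X. A ** X ** B) ` C"
      then show "X \<in> C"
        unfolding C_eq using act ne by blast
    next
      fix X assume "X \<in> C"
      then obtain u v where X: "X = mat u + mat v ** J" "u \<noteq> 0 \<or> v \<noteq> 0"
        unfolding C_eq by blast
      \<comment> \<open>As \<open>y * y = 1\<close>, multiplying the coefficient of \<open>J\<close>
        by \<open>y\<close> yields a preimage.\<close>
      then have "X = A ** (mat u + mat (v * y) ** J) ** B"
        using y(2) by (simp add: act mult.assoc)
      moreover have "mat u + mat (v * y) ** J \<in> C"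
        unfolding C_eq using X(2) ne by blast
      ultimately show "X \<in> (\<lambda>X. A ** X ** B) ` C" by blast
    qed
  qed
qed

section \<open>The Weber kernel groups\<close>

lemma weber_index_mem: "weber_index r s \<in> {0, 1, 2}"
  by (simp add: weber_index_def)

lemma weber_indexE:
  assumes "i \<in> {0, 1, 2}"
  obtains r s where "i = weber_index r s" "odd r \<or> odd s"
proof -
  have "0 = weber_index 1 1" "1 = weber_index 1 0" "2 = weber_index 0 1"
    by (simp_all add: weber_index_def)
  then show thesis using that assms by (metis insertE empty_iff odd_one)
qed

text \<open>The cube root of unity disappears in 24th powers, so these are merely permuted by the
  matrix modulo 2; as they are distinct, only the identity modulo 2 fixes all three.\<close>

lemma weber_u_24_invariant_iff:
  assumes det: "a * d - b * c = 1"
  shows "(\<forall>i \<in> {0, 1, 2}. \<forall>\<tau>. Im \<tau> > 0 \<longrightarrow>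
      weber_u i ((of_int a * \<tau> + of_int b) / (of_int c * \<tau> + of_int d)) ^ 24 = weber_u i \<tau> ^ 24) \<longleftrightarrow>
    odd a \<and> even b \<and> even c \<and> odd d"
proof -
  define g where "g \<tau> = (of_int a * \<tau> + of_int b) / (of_int c * \<tau> + of_int d)" for \<tau> :: complex
  have trans: "weber_u (weber_index r s) (g \<tau>) ^ 24 = weber_u (weber_index (r * a + s * c) (r * b + s * d)) \<tau> ^ 24"
    if "Im \<tau> > 0" "odd r \<or> odd s" for \<tau> r s
  proof -
    have "expi (2 * of_int (eta8_exponent a b c d) / 3) ^ 3 = expi (2 * of_int (3 * eta8_exponent a b c d) / 3)"
      by (simp add: expi_power)
    also have "\<dots> = 1"
      by (rule expi_third_eq_1_iff[THEN iffD2]) simp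
    finally have "(weber_u (weber_index r s) (g \<tau>) ^ 8) ^ 3 =
        (weber_u (weber_index (r * a + s * c) (r * b + s * d)) \<tau> ^ 8) ^ 3"
      unfolding g_def weber_u_transformation[OF det that] by (simp only: power_mult_distrib mult_1)
    then show ?thesis by (simp flip: power_mult)
  qed
  show ?thesis
    unfolding g_def[symmetric]
  proof
    assume inv: "\<forall>i \<in> {0, 1, 2}. \<forall>\<tau>. Im \<tau> > 0 \<longrightarrow> weber_u i (g \<tau>) ^ 24 = weber_u i \<tau> ^ 24"
    have fixed: "weber_index (r * a + s * c) (r * b + s * d) = weber_index r s" if "odd r \<or> odd s" for r s
    proof (rule weber_u_24_distinct[OF _ weber_index_mem weber_index_mem], intro allI impI)
      fix \<tau> :: complex assume "Im \<tau> > 0"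
      then show "weber_u (weber_index (r * a + s * c) (r * b + s * d)) \<tau> ^ 24 = weber_u (weber_index r s) \<tau> ^ 24"
        using trans that inv weber_index_mem by metis
    qed
    \<comment> \<open>The row \<open>(1, 0)\<close> gives the parities of \<open>a\<close> and
      \<open>b\<close>, the row \<open>(0, 1)\<close> only that of \<open>c\<close>;
      \<open>d\<close> is odd by the determinant.\<close>
    show "odd a \<and> even b \<and> even c \<and> odd d"
      using fixed[of 1 0] fixed[of 0 1] arg_cong[OF det, of odd] by (auto simp: weber_index_def split: if_splits)
  next
    assume "odd a \<and> even b \<and> even c \<and> odd d"
    then have fixed: "weber_index (r * a + s * c) (r * b + s * d) = weber_index r s" for r s
      by (simp add: weber_index_def)
    show "\<forall>i \<in> {0, 1, 2}. \<forall>\<tau>. Im \<tau> > 0 \<longrightarrow> weber_u i (g \<tau>) ^ 24 = weber_u i \<tau> ^ 24"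
    proof (intro ballI allI impI)
      fix i :: nat and \<tau> assume "i \<in> {0, 1, 2}" and \<tau>: "Im \<tau> > 0"
      then obtain r s where "i = weber_index r s" "odd r \<or> odd s"
        using weber_indexE by metis
      then show "weber_u i (g \<tau>) ^ 24 = weber_u i \<tau> ^ 24"
        using trans[OF \<tau>] fixed by metis
    qed
  qed
qed

lemma weber_u_8_Gamma_2:
  assumes det: "a * d - b * c = 1" and \<Gamma>: "odd a \<and> even b \<and> even c \<and> odd d"
    and "Im \<tau> > 0" "i \<in> {0, 1, 2}"
  shows "weber_u i ((of_int a * \<tau> + of_int b) / (of_int c * \<tau> + of_int d)) ^ 8 =
    expi (2 * of_int (eta8_exponent a b c d) / 3) * weber_u i \<tau> ^ 8"
proof -
  obtain r s where rs: "i = weber_index r s" "odd r \<or> odd s"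
    using weber_indexE[OF assms(4)] .
  have "weber_index (r * a + s * c) (r * b + s * d) = weber_index r s"
    using \<Gamma> by (simp add: weber_index_def)
  then show ?thesis
    using weber_u_transformation[OF det assms(3) rs(2)] by (simp add: rs)
qed

lemma PSL2Z_proj_mem_image_iff:
  assumes "A \<in> carrier SL2Z" "\<And>B. Q (- B) \<longleftrightarrow> Q B"
  shows "PSL2Z_proj A \<in> PSL2Z_proj ` {B \<in> carrier SL2Z. Q B} \<longleftrightarrow> Q A"
proof
  assume "PSL2Z_proj A \<in> PSL2Z_proj ` {B \<in> carrier SL2Z. Q B}"
  then obtain B where "Q B" "{A, - A} = {B, - B}"
    by (auto simp: PSL2Z_proj_eq)
  then have "A = B \<or> A = - B"
    by blast
  with \<open>Q B\<close> assms(2) show "Q A" by auto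
qed (use assms in auto)

lemma PSL2Z_proj_mem_weber_kernel_iff:
  assumes "A \<in> carrier SL2Z"
  shows "PSL2Z_proj A \<in> weber_kernel n \<longleftrightarrow> (\<forall>i \<in> {0, 1, 2}. \<forall>\<tau>. Im \<tau> > 0 \<longrightarrow>
    weber_u i (moebius A \<tau>) ^ (24 div n) = weber_u i \<tau> ^ (24 div n))"
  using assms by (simp add: weber_kernel_def carrier_PSL2Z PSL2Z_act_proj)

section \<open>Membership in the groups as conditions on matrix entries\<close>

lemma PSL2Z_proj_mem_principal_congruence_2_iff:
  assumes "A \<in> carrier SL2Z"
  shows "PSL2Z_proj A \<in> principal_congruence 2 \<longleftrightarrow>
    odd (A $ 1 $ 1) \<and> even (A $ 1 $ 2) \<and> even (A $ 2 $ 1) \<and> odd (A $ 2 $ 2)"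
proof -
  have "(\<forall>i j. [B $ i $ j = (mat 1 :: int ^ 2 ^ 2) $ i $ j] (mod int 2)) \<longleftrightarrow>
    odd (B $ 1 $ 1) \<and> even (B $ 1 $ 2) \<and> even (B $ 2 $ 1) \<and> odd (B $ 2 $ 2)" for B :: "int ^ 2 ^ 2"
    by (simp add: forall_2 mat_def cong_def even_iff_mod_2_eq_zero odd_iff_mod_2_eq_one conj_assoc)
  then show ?thesis
    unfolding principal_congruence_def by (simp add: PSL2Z_proj_mem_image_iff[OF assms])
qed

text \<open>For determinant 1, both conditions describe the quaternion group modulo 3, whatever
  \<open>C\<close> is. The exponent is the same for a matrix and its negative, so divisibility
  descends to \<open>PSL2Z\<close>.\<close>

lemma PSL2Z_proj_mem_Gamma_ns_plus_iff:
  assumes C: "nonsplit_Cartan C" and A: "A \<in> carrier SL2Z"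
  shows "PSL2Z_proj A \<in> Gamma_ns_plus C \<longleftrightarrow>
    3 dvd eta8_exponent (A $ 1 $ 1) (A $ 1 $ 2) (A $ 2 $ 1) (A $ 2 $ 2)"
proof -
  define Q where "Q B \<longleftrightarrow> det B = 1 \<and> 3 dvd eta8_exponent (B $ 1 $ 1) (B $ 1 $ 2) (B $ 2 $ 1) (B $ 2 $ 2)"
    for B :: "int ^ 2 ^ 2"
  have norm: "map_matrix of_int B \<in> normalizer GL2F3 C \<longleftrightarrow> Q B" if "det B = 1" for B
  proof -
    have "of_int (det B) = (1::3)"
      using that by simp
    then have det: "of_int (B $ 1 $ 1) * of_int (B $ 2 $ 2) - of_int (B $ 1 $ 2) * of_int (B $ 2 $ 1) = (1::3)"
      by (simp add: det_2)
    then have "det (map_matrix of_int B :: 3 ^ 2 ^ 2) = 1"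
      by (simp add: det_2 map_matrix_def)
    from normalizer_nonsplit_Cartan_iff[OF C this] eta8_exponent_F3[OF det]
    have "map_matrix of_int B \<in> normalizer GL2F3 C \<longleftrightarrow>
      (of_int (eta8_exponent (B $ 1 $ 1) (B $ 1 $ 2) (B $ 2 $ 1) (B $ 2 $ 2)) :: 3) = 0"
      by (simp add: map_matrix_def eta8_exponent_def power2_eq_square)
    with that show ?thesis
      by (simp add: of_int_F3_eq_0_iff Q_def)
  qed
  have "Gamma_ns_plus C = PSL2Z_proj ` {B \<in> carrier SL2Z. Q B}"
    unfolding Gamma_ns_plus_def using norm by (intro arg_cong2[where f = image]) (auto simp: SL2Z_def)
  moreover have "PSL2Z_proj A \<in> PSL2Z_proj ` {B \<in> carrier SL2Z. Q B} \<longleftrightarrow> Q A"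
    by (rule PSL2Z_proj_mem_image_iff[OF A]) (simp add: Q_def det_neg_2 eta8_exponent_def algebra_simps)
  ultimately show ?thesis
    using A by (simp add: Q_def SL2Z_def)
qed

lemma weber_kernel_multiple_3_iff:
  assumes A: "A \<in> carrier SL2Z" and n: "n dvd 8"
  shows "PSL2Z_proj A \<in> weber_kernel (3 * n) \<longleftrightarrow> PSL2Z_proj A \<in> weber_kernel n \<and>
    3 dvd eta8_exponent (A $ 1 $ 1) (A $ 1 $ 2) (A $ 2 $ 1) (A $ 2 $ 2)"
    (is "_ \<longleftrightarrow> _ \<and> 3 dvd ?k")
proof -
  have det: "A $ 1 $ 1 * A $ 2 $ 2 - A $ 1 $ 2 * A $ 2 $ 1 = 1"
    using A by (simp add: SL2Z_def det_2)
  define m where "m = 8 div n"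
  have "n * m = 8"
    using n by (simp add: m_def)
  moreover from this have "n \<noteq> 0"
    by (metis mult_0 zero_neq_numeral)
  moreover have "24 = n * (m * 3)" "24 = 3 * n * m"
    using \<open>n * m = 8\<close> by (simp_all add: mult.assoc flip: mult.assoc[of n])
  ultimately have m: "n * m = 8" "24 div n = m * 3" "24 div (3 * n) = m"
    by (metis mult_eq_0_iff nonzero_mult_div_cancel_left zero_neq_numeral)+
  define invar where "invar k \<longleftrightarrow> (\<forall>i \<in> {0, 1, 2}. \<forall>\<tau>. Im \<tau> > 0 \<longrightarrow>
    weber_u i (moebius A \<tau>) ^ k = weber_u i \<tau> ^ k)" for k
  have invar_mult: "invar (k * l)" if "invar k" for k l
    using that by (simp add: invar_def power_mult)
  have \<Gamma>2: "invar 24 \<longleftrightarrow> odd (A $ 1 $ 1) \<and> even (A $ 1 $ 2) \<and> even (A $ 2 $ 1) \<and> odd (A $ 2 $ 2)"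
    unfolding invar_def moebius_def using weber_u_24_invariant_iff[OF det] .
  have u8: "weber_u i (moebius A \<tau>) ^ 8 = expi (2 * of_int ?k / 3) * weber_u i \<tau> ^ 8"
    if "invar 24" "Im \<tau> > 0" "i \<in> {0, 1, 2}" for i \<tau>
    unfolding moebius_def using weber_u_8_Gamma_2[OF det] that \<Gamma>2 by blast
  have "invar m \<longleftrightarrow> invar (m * 3) \<and> 3 dvd ?k"
  proof (intro iffI conjI)
    assume invar: "invar m"
    show "invar (m * 3)" using invar by (rule invar_mult)
    \<comment> \<open>\<open>m\<close> divides 8, so eighth powers are invariant; comparison with
      the transformation law at one nonzero value makes the cube root of unity equal to 1.\<close>
    have "invar 8" using invar_mult[OF invar, of n] m(1) by (simp add: mult.commute)
    moreover from this have "invar 24" using invar_mult[of 8 3] by simp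
    ultimately have "expi (2 * of_int ?k / 3) * weber_u 0 \<i> ^ 8 = weber_u 0 \<i> ^ 8"
      using u8[of \<i> 0] by (simp add: invar_def)
    then show "3 dvd ?k"
      using weber_u_nonzero[of \<i> 0] by (simp add: expi_third_eq_1_iff)
  next
    assume *: "invar (m * 3) \<and> 3 dvd ?k"
    have "m * 3 * n = 3 * (n * m)" by simp
    then have eq: "m * 3 * n = 24" unfolding m(1) by simp
    have "invar 24" using invar_mult[of "m * 3" n] * unfolding eq by simp
    show "invar m"
      unfolding invar_def
    proof (intro ballI allI impI)
      fix i :: nat and \<tau> assume i: "i \<in> {0, 1, 2}" and \<tau>: "Im \<tau> > 0"
      define x y where "x = weber_u i (moebius A \<tau>) ^ m" and "y = weber_u i \<tau> ^ m"
      have 3: "x ^ 3 = y ^ 3"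
        using * i \<tau> unfolding x_def y_def power_mult[symmetric] invar_def by blast
      have "weber_u i (moebius A \<tau>) ^ 8 = weber_u i \<tau> ^ 8"
        using u8[OF \<open>invar 24\<close> \<tau> i] * by (simp add: expi_third_eq_1_iff)
      then have 8: "x ^ 8 = y ^ 8"
        unfolding x_def y_def by (metis power_mult mult.commute)
      \<comment> \<open>As 3 and 8 are coprime, equal cubes and equal eighth powers force equality:
        divide the ninth powers by the eighth.\<close>
      have "x ^ 8 * x = (x ^ 3) ^ 3" "y ^ 8 * y = (y ^ 3) ^ 3"
        by (simp_all add: eval_nat_numeral)
      then have "y ^ 8 * x = y ^ 8 * y"
        using 3 8 by simp
      moreover have "y \<noteq> 0"
        using weber_u_nonzero[OF \<tau>] by (simp add: y_def)
      ultimately show "x = y" by simp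
    qed
  qed
  then show ?thesis
    unfolding PSL2Z_proj_mem_weber_kernel_iff[OF A] m invar_def .
qed

theorem proposition7:
  fixes C :: "(3 ^ 2 ^ 2) set"
  assumes "nonsplit_Cartan C"
  shows "weber_kernel 3 = principal_congruence 2 \<inter> Gamma_ns_plus C \<and>
    (\<forall>n::nat. n dvd 8 \<longrightarrow> weber_kernel (3 * n) = weber_kernel n \<inter> Gamma_ns_plus C)"
proof -
  have sub: "weber_kernel n \<subseteq> carrier PSL2Z" "principal_congruence n \<subseteq> carrier PSL2Z" for n
    by (auto simp: weber_kernel_def principal_congruence_def carrier_PSL2Z)
  have eqI: "X = Y" if "X \<subseteq> carrier PSL2Z" "Y \<subseteq> carrier PSL2Z"
    "\<And>A. A \<in> carrier SL2Z \<Longrightarrow> PSL2Z_proj A \<in> X \<longleftrightarrow> PSL2Z_proj A \<in> Y" for X Y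
    using that unfolding carrier_PSL2Z by blast
  have n: "weber_kernel (3 * n) = weber_kernel n \<inter> Gamma_ns_plus C" if "n dvd 8" for n
    using sub by (intro eqI)
      (auto simp: weber_kernel_multiple_3_iff[OF _ that] PSL2Z_proj_mem_Gamma_ns_plus_iff[OF assms])
  \<comment> \<open>The first claim is the case \<open>n = 1\<close> of the second once this
    identity is known.\<close>
  have "weber_kernel 1 = principal_congruence 2"
  proof (intro eqI sub)
    fix A assume A: "A \<in> carrier SL2Z"
    then have "A $ 1 $ 1 * A $ 2 $ 2 - A $ 1 $ 2 * A $ 2 $ 1 = 1"
      by (simp add: SL2Z_def det_2)
    from weber_u_24_invariant_iff[OF this]
    show "PSL2Z_proj A \<in> weber_kernel 1 \<longleftrightarrow> PSL2Z_proj A \<in> principal_congruence 2"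
      unfolding PSL2Z_proj_mem_weber_kernel_iff[OF A] PSL2Z_proj_mem_principal_congruence_2_iff[OF A]
        moebius_def by simp
  qed
  then show ?thesis
    using n[of 1] n by simp
qed

end
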